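(* Let $\mathcal{F}$ be a species of 3-connected graphs and let $\mathcal{B}=\mathcal{B}_{\mathcal{F}}$ be the species of 2-connected graphs all of whose 3-connected components belong to $\mathcal{F}$ (by convention $K_2\in\mathcal{B}$). Let $\mathcal{B}^{\circ}$ be the species of graphs $g\in\mathcal{B}$ rooted at a distinguished 3-component, $\mathcal{B}^{\bullet}$ the species of graphs $g\in\mathcal{B}$ with a distinguished bond, and $\mathcal{B}^{\circ-\bullet}$ the species of graphs $g\in\mathcal{B}$ with a distinguished pair consisting of a 3-component and a bond that are adjacent in the tree $\mathrm{tc}(g)$. Then there is a species isomorphism $$\mathcal{B}^{\circ}+\mathcal{B}^{\bullet}=\mathcal{B}-K_2+\mathcal{B}^{\circ-\bullet}.$$
   Context: All graphs are finite and simple (no loops or multiple edges). A graph is $k$-connected if it has more than $k$ vertices and at least $k$ vertices must be deleted to disconnect it; by convention the one-edge graph $K_2$ is considered 2-connected. A species is a class of labelled structures closed under relabelling along bijections of the underlying (vertex) sets; identities between species are isomorphisms compatible with relabellings. 3-decomposition: every 2-connected simple graph $g$ has a unique decomposition into 3-components, each of which is either a 3-connected graph (a 3-connected component of $g$) or a polygon (unoriented cycle of length $\ge 3$). It is obtained by splitting $g$ along separating pairs $\{x,y\}$ (pairs of vertices whose removal disconnects $g$): in each resulting piece one reinserts $x$, $y$, their incident edges and the edge $xy$ (recording whether $xy$ is an edge of $g$); polygonal components are kept maximal, i.e. one does not split along separating pairs that would cut a polygon into smaller polygons. The separating pairs actually used are called the bonds of $g$; a bond $\{x,y\}$ links two or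 more 3-components (possibly together with the edge $xy$ of $g$), the case of exactly two polygons alone being excluded. The tree $\mathrm{tc}(g)$ is the bicolored tree whose white vertices are the 3-components of $g$ and whose black vertices are the bonds, a bond being adjacent to the 3-components it links. A 2-connected graph with no separating pair (e.g. $K_2$ or a 3-connected graph) has no bonds. *)

theory Defs
  imports Main
begin

datatype 'v ugraph = UGraph (verts: "'v set") (edges: "'v set set")

definition simple_graph :: "'v ugraph \<Rightarrow> bool" where
  "simple_graph g \<longleftrightarrow>
     finite (verts g) \<and> (\<forall>e\<in>edges g. e \<subseteq> verts g \<and> card e = 2)"

definition relabel :: "('v \<Rightarrow> 'w) \<Rightarrow> 'v ugraph \<Rightarrow> 'w ugraph" where
  "relabel f g = UGraph (f ` verts g) ((\<lambda>e. f ` e) ` edges g)"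

definition delete_verts :: "'v ugraph \<Rightarrow> 'v set \<Rightarrow> 'v ugraph" where
  "delete_verts g S = UGraph (verts g - S) {e \<in> edges g. e \<inter> S = {}}"

definition adj :: "'v ugraph \<Rightarrow> ('v \<times> 'v) set" where
  "adj g = {(u, v). {u, v} \<in> edges g}"

text \<open>The empty graph counts as connected, so deleting both vertices of the one-edge graph
  does not disconnect it.\<close>

definition connected_graph :: "'v ugraph \<Rightarrow> bool" where
  "connected_graph g \<longleftrightarrow> (\<forall>u\<in>verts g. \<forall>v\<in>verts g. (u, v) \<in> (adj g)\<^sup>*)"

definition connected_classes :: "'v ugraph \<Rightarrow> 'v set set" where
  "connected_classes g = (\<lambda>u. {v \<in> verts g. (u, v) \<in> (adj g)\<^sup>*}) ` verts g"

definition k_connected :: "nat \<Rightarrow> 'v ugraph \<Rightarrow> bool" where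
  "k_connected k g \<longleftrightarrow> simple_graph g \<and> k < card (verts g) \<and>
     (\<forall>S \<subseteq> verts g. card S < k \<longrightarrow> connected_graph (delete_verts g S))"

definition is_K2 :: "'v ugraph \<Rightarrow> bool" where
  "is_K2 g \<longleftrightarrow> (\<exists>x y. x \<noteq> y \<and> g = UGraph {x, y} {{x, y}})"

definition two_connected :: "'v ugraph \<Rightarrow> bool" where
  "two_connected g \<longleftrightarrow> k_connected 2 g \<or> is_K2 g"

definition polygon :: "'v ugraph \<Rightarrow> bool" where
  "polygon g \<longleftrightarrow> (\<exists>vs. distinct vs \<and> 3 \<le> length vs \<and>
     g = UGraph (set vs) {{vs ! i, vs ! (Suc i mod length vs)} | i. i < length vs})"

definition separating_pair :: "'v ugraph \<Rightarrow> 'v \<Rightarrow> 'v \<Rightarrow> bool" where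
  "separating_pair g x y \<longleftrightarrow> x \<noteq> y \<and> x \<in> verts g \<and> y \<in> verts g \<and>
     \<not> connected_graph (delete_verts g {x, y})"

definition pieces :: "'v ugraph \<Rightarrow> 'v \<Rightarrow> 'v \<Rightarrow> 'v ugraph set" where
  "pieces g x y =
     (\<lambda>K. UGraph (K \<union> {x, y}) (insert {x, y} {e \<in> edges g. e \<subseteq> K \<union> {x, y}}))
       ` connected_classes (delete_verts g {x, y})"

text \<open>\<open>splits_into g C D\<close>: repeated splitting of \<open>g\<close> along the separating pairs in \<open>D\<close> ends with
  the set of pieces \<open>C\<close>. A set suffices, since every final piece has at least three
  vertices and any two of them share at most two. The pieces contain the reinserted edges; a pair in \<open>D\<close>
  is an original edge iff it belongs to \<open>edges g\<close> for the initial graph.\<close>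

inductive splits_into :: "'v ugraph \<Rightarrow> 'v ugraph set \<Rightarrow> 'v set set \<Rightarrow> bool" where
  stop: "k_connected 3 g \<or> polygon g \<Longrightarrow> splits_into g {g} {}"
| split: "separating_pair g x y \<Longrightarrow> \<forall>p\<in>pieces g x y. splits_into p (C p) (D p) \<Longrightarrow>
    splits_into g (\<Union>p\<in>pieces g x y. C p) (insert {x, y} (\<Union>p\<in>pieces g x y. D p))"

definition linked :: "'v ugraph set \<Rightarrow> 'v set \<Rightarrow> 'v ugraph set" where
  "linked C b = {c \<in> C. b \<in> edges c}"

text \<open>The last conjunct expresses maximality of the polygons: a pair that only glues two polygons,
  without being an edge of \<open>g\<close>, must not be used. The one-edge graph is
  neither 3-connected nor a polygon and has no 3-components.\<close>

definition is_three_decomposition :: "'v ugraph \<Rightarrow> 'v ugraph set \<times> 'v set set \<Rightarrow> bool" where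
  "is_three_decomposition g = (\<lambda>(C, D).
     if is_K2 g then C = {} \<and> D = {}
     else splits_into g C D \<and>
       \<not> (\<exists>b\<in>D. b \<notin> edges g \<and> card (linked C b) = 2 \<and> (\<forall>c\<in>linked C b. polygon c)))"

definition three_decomposition :: "'v ugraph \<Rightarrow> 'v ugraph set \<times> 'v set set" where
  "three_decomposition g = (THE CD. is_three_decomposition g CD)"

definition three_components :: "'v ugraph \<Rightarrow> 'v ugraph set" where
  "three_components g = fst (three_decomposition g)"

definition bonds :: "'v ugraph \<Rightarrow> 'v set set" where
  "bonds g = snd (three_decomposition g)"

definition tc :: "'v ugraph \<Rightarrow> ('v ugraph + 'v set) ugraph" where
  "tc g = UGraph (Inl ` three_components g \<union> Inr ` bonds g)
     {{Inl c, Inr b} | c b. b \<in> bonds g \<and> c \<in> linked (three_components g) b}"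

text \<open>Species are functors on the finite subsets of a type \<open>'v\<close> and the bijections between them:
  \<open>transport S U f\<close> relabels structures on \<open>U\<close> along a bijection given by \<open>f\<close> on \<open>U\<close>.\<close>

record ('v, 's) species =
  structs :: "'v set \<Rightarrow> 's set"
  transport :: "'v set \<Rightarrow> ('v \<Rightarrow> 'v) \<Rightarrow> 's \<Rightarrow> 's"

definition is_species :: "('v, 's) species \<Rightarrow> bool" where
  "is_species S \<longleftrightarrow>
     (\<forall>U. finite U \<longrightarrow> finite (structs S U)) \<and>
     (\<forall>U V f. finite U \<longrightarrow> bij_betw f U V \<longrightarrow>
        (\<forall>s\<in>structs S U. transport S U f s \<in> structs S V)) \<and>
     (\<forall>U f. finite U \<longrightarrow> (\<forall>x\<in>U. f x = x) \<longrightarrow>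
        (\<forall>s\<in>structs S U. transport S U f s = s)) \<and>
     (\<forall>U V W f g h. finite U \<longrightarrow> bij_betw f U V \<longrightarrow> bij_betw g V W \<longrightarrow>
        (\<forall>x\<in>U. h x = g (f x)) \<longrightarrow>
        (\<forall>s\<in>structs S U. transport S U h s = transport S V g (transport S U f s)))"

definition species_iso :: "('v, 's) species \<Rightarrow> ('v, 't) species \<Rightarrow> bool"  (infix "\<cong>\<^sub>S" 50) where
  "S \<cong>\<^sub>S T \<longleftrightarrow> is_species S \<and> is_species T \<and>
     (\<exists>\<phi>. (\<forall>U. finite U \<longrightarrow> bij_betw (\<phi> U) (structs S U) (structs T U)) \<and>
          (\<forall>U V f. finite U \<longrightarrow> bij_betw f U V \<longrightarrow>
             (\<forall>s\<in>structs S U. \<phi> V (transport S U f s) = transport T U f (\<phi> U s))))"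

definition species_sum ::
  "('v, 's) species \<Rightarrow> ('v, 't) species \<Rightarrow> ('v, 's + 't) species"  (infixl "+\<^sub>S" 65) where
  "S +\<^sub>S T = \<lparr>structs = (\<lambda>U. structs S U <+> structs T U),
     transport = (\<lambda>U f. map_sum (transport S U f) (transport T U f))\<rparr>"

text \<open>Difference of a species and a subspecies of it.\<close>

definition species_diff ::
  "('v, 's) species \<Rightarrow> ('v, 's) species \<Rightarrow> ('v, 's) species"  (infixl "-\<^sub>S" 65) where
  "S -\<^sub>S T = \<lparr>structs = (\<lambda>U. structs S U - structs T U), transport = transport S\<rparr>"

definition graph_species :: "'v ugraph set \<Rightarrow> ('v, 'v ugraph) species" where
  "graph_species A = \<lparr>structs = (\<lambda>U. {g \<in> A. verts g = U}), transport = (\<lambda>U f. relabel f)\<rparr>"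

definition K2_species :: "('v, 'v ugraph) species" where
  "K2_species = graph_species {g. is_K2 g}"

definition B_class :: "'v ugraph set \<Rightarrow> 'v ugraph set" where
  "B_class F = {g. two_connected g \<and> (\<forall>c\<in>three_components g. k_connected 3 c \<longrightarrow> c \<in> F)}"

definition B_species :: "'v ugraph set \<Rightarrow> ('v, 'v ugraph) species" where
  "B_species F = graph_species (B_class F)"

definition B_component_rooted :: "'v ugraph set \<Rightarrow> ('v, 'v ugraph \<times> 'v ugraph) species" where
  "B_component_rooted F =
     \<lparr>structs = (\<lambda>U. {(g, c). g \<in> structs (B_species F) U \<and> c \<in> three_components g}),
      transport = (\<lambda>U f (g, c). (relabel f g, relabel f c))\<rparr>"

definition B_bond_rooted :: "'v ugraph set \<Rightarrow> ('v, 'v ugraph \<times> 'v set) species" where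
  "B_bond_rooted F =
     \<lparr>structs = (\<lambda>U. {(g, b). g \<in> structs (B_species F) U \<and> b \<in> bonds g}),
      transport = (\<lambda>U f (g, b). (relabel f g, f ` b))\<rparr>"

definition B_component_bond_rooted ::
  "'v ugraph set \<Rightarrow> ('v, 'v ugraph \<times> 'v ugraph \<times> 'v set) species" where
  "B_component_bond_rooted F =
     \<lparr>structs = (\<lambda>U. {(g, c, b). g \<in> structs (B_species F) U \<and> {Inl c, Inr b} \<in> edges (tc g)}),
      transport = (\<lambda>U f (g, c, b). (relabel f g, relabel f c, f ` b))\<rparr>"

end

theory Submission
  imports Defs
begin

text \<open>Both sides are sums over graphs \<open>g\<close>, so the theorem is the dissymmetry theorem for the tree
  \<open>tc g\<close>, made compatible with relabelling. Orient each edge of the tree towards its heavier side, the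
  sides of an incidence between a component \<open>c\<close> and a bond \<open>b\<close> being weighed by the vertices
  of the graph behind \<open>b\<close> as seen from \<open>c\<close> and by the remaining ones. Two edges at a
  common node cannot both have their lighter side there, so mapping an edge to the endpoint
  on its lighter side is injective. As a tree has one node more than edges, exactly one node is missed; it
  corresponds to the graph itself.

  That the decomposition into 3-components is a well-defined function of \<open>g\<close> rests on a description
  of its bonds that does not mention the order of splitting: they are the separating pairs whose two
  vertices are not separated by any other pair. A 2-connected graph with a separating pair, all of
  whose separating pairs are crossed in this sense, is a polygon; and a crossed pair used for splitting
  would be a removable pair between two polygons.\<close>

subsection \<open>Reachability avoiding a set of vertices\<close>

text \<open>Two obstacles shape the proof. Splitting replaces a graph by pieces that carry a
  reinserted edge, so adjacency changes from stage to stage. Separation is therefore phrased by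
  \<open>reach E S\<close>, which knows only an edge set and a forbidden vertex set. A walk is
  projected to a piece by shortcutting its detours along the reinserted edge, and lifted back by
  replacing that edge by a detour, so crossing and sides of a bond can be tested in the original
  graph at every stage.

  The bijection must also commute with all relabellings, in particular with the automorphisms of a
  graph, so it cannot depend on choices. The weights are cardinalities, and ties are broken by the
  kind of a node, component or bond; relabelling preserves both.

  That \<open>tc g\<close> is a tree enters as a count, one node more than incidences, proved by
  induction on the splitting. The sides of an incidence are taken in \<open>g\<close> itself rather
  than in the tree.\<close>

definition reach :: "'v set set \<Rightarrow> 'v set \<Rightarrow> 'v \<Rightarrow> 'v \<Rightarrow> bool" where
  "reach E S a b \<longleftrightarrow> (a, b) \<in> {(u, v). {u, v} \<in> E \<and> u \<notin> S \<and> v \<notin> S}\<^sup>*"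

lemma reach_refl [simp]: "reach E S a a"
  by (simp add: reach_def)

lemma reach_trans [trans]: "reach E S a b \<Longrightarrow> reach E S b c \<Longrightarrow> reach E S a c"
  unfolding reach_def by (rule rtrancl_trans)

lemma reach_edge: "{u, v} \<in> E \<Longrightarrow> u \<notin> S \<Longrightarrow> v \<notin> S \<Longrightarrow> reach E S u v"
  unfolding reach_def by blast

text \<open>Path arguments below typically take this form: rather than following a walk, they
  exhibit a set \<open>A\<close> that no allowed step leaves.\<close>

lemma reach_closed:
  assumes "reach E S a b" "a \<in> A"
    and "\<And>u v. u \<in> A \<Longrightarrow> {u, v} \<in> E \<Longrightarrow> u \<notin> S \<Longrightarrow> v \<notin> S \<Longrightarrow> v \<in> A"
  shows "b \<in> A"
  using assms(1) unfolding reach_def by (induction rule: rtrancl_induct) (use assms in auto)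

lemma reach_subst:
  assumes "reach E S a b"
    and "\<And>u v. {u, v} \<in> E \<Longrightarrow> u \<notin> S \<Longrightarrow> v \<notin> S \<Longrightarrow> reach E' S' u v"
  shows "reach E' S' a b"
  using reach_closed[OF assms(1), of "{w. reach E' S' a w}"] assms(2) reach_trans by fastforce

lemma reach_mono: "reach E S a b \<Longrightarrow> E \<subseteq> E' \<Longrightarrow> S' \<subseteq> S \<Longrightarrow> reach E' S' a b"
  by (erule reach_subst) (blast intro: reach_edge)

lemma reach_sym: "reach E S a b \<Longrightarrow> reach E S b a"
  by (rule reach_closed[of E S a b "{w. reach E S w a}", simplified])
    (simp_all, metis insert_commute reach_edge reach_trans)

lemma reach_pair: "reach E S x y \<Longrightarrow> {a, b} = {x, y} \<Longrightarrow> reach E S a b"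
  using reach_sym[of E S x y] by (auto simp: doubleton_eq_iff)

text \<open>Cut the walk at its first vertex \<open>z\<close> in \<open>X\<close>. The part before
  it meets \<open>X\<close> nowhere else, hence the forbidden set \<open>X - {z}\<close>.\<close>

lemma reach_first_hit:
  assumes "reach E S w t" "t \<in> X" "w \<notin> X"
  obtains z where "z \<in> X" "z \<notin> S" "reach E (X - {z}) w z"
proof -
  let ?hit = "\<exists>z\<in>X. z \<notin> S \<and> reach E (X - {z}) w z"
  have "t \<in> {t. ?hit \<or> t \<notin> X \<and> reach E X w t}"
  proof (rule reach_closed[OF assms(1)])
    fix u v
    assume u: "u \<in> {t. ?hit \<or> t \<notin> X \<and> reach E X w t}" and e: "{u, v} \<in> E" "u \<notin> S" "v \<notin> S"
    show "v \<in> {t. ?hit \<or> t \<notin> X \<and> reach E X w t}"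
    proof (cases ?hit)
      case False
      with u have u: "u \<notin> X" "reach E X w u" by auto
      show ?thesis
      proof (cases "v \<in> X")
        case True
        have "reach E (X - {v}) w u" using u(2) by (rule reach_mono) auto
        also have "reach E (X - {v}) u v" using e u by (intro reach_edge) auto
        finally show ?thesis using True e by auto
      next
        case False
        then have "reach E X u v" using e u by (intro reach_edge) auto
        then have "reach E X w v" by (rule reach_trans[OF u(2)])
        then show ?thesis using False by simp
      qed
    qed simp
  qed (use assms in auto)
  then show thesis using that assms(2) by blast
qed

text \<open>An excursion out of \<open>K \<union> {x, y}\<close> leaves and returns through
  \<open>x\<close> or \<open>y\<close>. It is dropped if both times the same end is used, and
  replaced by the inserted edge otherwise.\<close>

lemma reach_project:
  assumes "reach E S s t" "s \<in> K \<union> {x, y}" "t \<in> K \<union> {x, y}"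
    and closed: "\<And>e. e \<in> E \<Longrightarrow> e \<inter> K \<noteq> {} \<Longrightarrow> e \<subseteq> K \<union> {x, y}"
  shows "reach (insert {x, y} {e \<in> E. e \<subseteq> K \<union> {x, y}}) S s t"
proof -
  let ?P = "K \<union> {x, y}" and ?E = "insert {x, y} {e \<in> E. e \<subseteq> K \<union> {x, y}}"
  \<comment> \<open>While the walk is outside, the invariant remembers an end outside
    \<open>S\<close> that was reached within the piece; from there the walk can be resumed at either
    end.\<close>
  let ?A = "{w. (w \<in> ?P \<longrightarrow> reach ?E S s w) \<and>
      (w \<notin> ?P \<longrightarrow> (\<exists>z\<in>{x, y}. z \<notin> S \<and> reach ?E S s z))}"
  have "t \<in> ?A"
  proof (rule reach_closed[OF assms(1)])
    show "s \<in> ?A" 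
      by (intro CollectI conjI impI) (rule reach_refl, use assms(2) in blast)
    fix u v assume u: "u \<in> ?A" and e: "{u, v} \<in> E" "u \<notin> S" "v \<notin> S"
    consider "u \<in> ?P" "v \<in> ?P" | "u \<in> ?P" "v \<notin> ?P" | "u \<notin> ?P" "v \<in> ?P" | "u \<notin> ?P" "v \<notin> ?P"
      by blast
    then show "v \<in> ?A"
    proof cases
      case 1
      then have "reach ?E S s u" "reach ?E S u v" using u e by (blast intro: reach_edge)+
      then have "reach ?E S s v" by (rule reach_trans)
      then show ?thesis using 1 by blast
    next
      case 2
      then have "u \<in> {x, y}" using closed[of "{u, v}"] e by auto
      then show ?thesis using 2 u e by blast
    next
      case 3
      then have v: "v \<in> {x, y}" using closed[of "{u, v}"] e by auto
      from u 3 obtain z where z: "z \<in> {x, y}" "z \<notin> S" "reach ?E S s z" by blast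
      have "reach ?E S z v"
      proof (cases "z = v")
        case False
        then have "{z, v} = {x, y}" using z v by auto
        then show ?thesis using z e by (intro reach_edge) auto
      qed simp
      with z(3) have "reach ?E S s v" by (rule reach_trans)
      then show ?thesis using 3 by blast
    next
      case 4
      then show ?thesis using u by blast
    qed
  qed
  then show ?thesis using assms(3) by blast
qed

text \<open>The inserted edge is simulated by a walk of the original graph, which has to exist only
  if the edge is usable, that is, if both ends avoid \<open>S\<close>.\<close>

lemma reach_lift:
  assumes "reach (insert {x, y} {e \<in> E. e \<subseteq> P}) S s t"
    and "x \<notin> S \<Longrightarrow> y \<notin> S \<Longrightarrow> reach E S x y"
  shows "reach E S s t"
  using assms(1)
proof (rule reach_subst)
  fix u v assume e: "{u, v} \<in> insert {x, y} {e \<in> E. e \<subseteq> P}" "u \<notin> S" "v \<notin> S"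
  then show "reach E S u v"
    using assms(2) reach_sym[of E S x y] by (auto simp: doubleton_eq_iff intro: reach_edge)
qed

subsection \<open>2-connected graphs and their pieces\<close>

abbreviation biconnected :: "'v ugraph \<Rightarrow> bool" where
  "biconnected g \<equiv> k_connected 2 g"

lemma connected_delete_iff:
  "connected_graph (delete_verts g S) \<longleftrightarrow>
     (\<forall>u\<in>verts g - S. \<forall>v\<in>verts g - S. reach (edges g) S u v)"
proof -
  have "adj (delete_verts g S) = {(u, v). {u, v} \<in> edges g \<and> u \<notin> S \<and> v \<notin> S}"
    by (auto simp: adj_def delete_verts_def)
  then show ?thesis by (simp add: connected_graph_def reach_def delete_verts_def)
qed

lemma connected_classes_delete:
  "connected_classes (delete_verts g S) =
     (\<lambda>u. {v \<in> verts g - S. reach (edges g) S u v}) ` (verts g - S)"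
proof -
  have "adj (delete_verts g S) = {(u, v). {u, v} \<in> edges g \<and> u \<notin> S \<and> v \<notin> S}"
    by (auto simp: adj_def delete_verts_def)
  then show ?thesis by (simp add: connected_classes_def reach_def delete_verts_def)
qed

lemma simple_edge:
  assumes "simple_graph g" "{u, v} \<in> edges g"
  shows "u \<in> verts g" "v \<in> verts g" "u \<noteq> v"
  using assms by (fastforce simp: simple_graph_def)+

lemma biconnectedD:
  assumes "biconnected g"
  shows "simple_graph g" "finite (verts g)" "2 < card (verts g)"
  using assms by (auto simp: k_connected_def simple_graph_def)

lemma biconnected_reach:
  assumes "biconnected g" "a \<in> verts g - {z}" "b \<in> verts g - {z}"
  shows "reach (edges g) {z} a b"
proof (cases "z \<in> verts g")
  case True
  then have "connected_graph (delete_verts g {z})"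
    using assms(1) by (simp add: k_connected_def)
  then show ?thesis using assms by (simp add: connected_delete_iff)
next
  case False
  have "connected_graph (delete_verts g {})"
    using assms(1) unfolding k_connected_def by (metis card.empty empty_subsetI zero_less_numeral)
  then have "reach (edges g) {} a b" using assms by (simp add: connected_delete_iff)
  then show ?thesis
    using False simple_edge[OF biconnectedD(1)[OF assms(1)]]
    by (elim reach_subst) (metis reach_edge singletonD)
qed

lemma biconnectedI:
  assumes "simple_graph g" "2 < card (verts g)"
    and "\<And>z a b. a \<in> verts g - {z} \<Longrightarrow> b \<in> verts g - {z} \<Longrightarrow> reach (edges g) {z} a b"
  shows "biconnected g"
  unfolding k_connected_def connected_delete_iff
proof (intro conjI allI impI ballI)
  fix S u v assume S: "S \<subseteq> verts g" "card S < 2" and uv: "u \<in> verts g - S" "v \<in> verts g - S"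
  have "finite S" using S assms(1) by (auto simp: simple_graph_def intro: finite_subset)
  moreover have "card S = 0 \<or> card S = 1" using S by auto
  ultimately consider "S = {}" | z where "S = {z}" by (auto simp: card_1_singleton_iff)
  then show "reach (edges g) S u v"
  proof cases
    case 1
    \<comment> \<open>With nothing deleted, a vertex \<open>z\<close> besides \<open>u\<close> and
      \<open>v\<close> is deleted instead; the bound on the number of vertices provides it.\<close>
    have "card {u, v} < card (verts g)" using assms(2) card_insert_le_m1[of 2 "{v}" u] by simp
    then obtain z where "z \<in> verts g" "z \<notin> {u, v}"
      by (metis card_mono finite.emptyI finite.insertI not_less subsetI)
    then have "reach (edges g) {z} u v" using uv by (intro assms(3)) auto
    then show ?thesis unfolding 1 by (rule reach_mono) auto
  next
    case 2
    then show ?thesis using assms(3) uv by simp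
  qed
qed (use assms in auto)

text \<open>Otherwise deleting \<open>y\<close> would cut \<open>A\<close> off from
  \<open>x\<close>.\<close>

lemma biconnected_neighbour:
  assumes g: "biconnected g" and A: "A \<noteq> {}" "A \<subseteq> verts g" "x \<in> verts g" "x \<notin> A" "y \<notin> A" "x \<noteq> y"
    and N: "\<And>a w. a \<in> A \<Longrightarrow> {a, w} \<in> edges g \<Longrightarrow> w \<in> A \<union> {x, y}"
  shows "\<exists>a\<in>A. {x, a} \<in> edges g"
proof (rule ccontr)
  assume no: "\<not> ?thesis"
  obtain a where a: "a \<in> A" using A by blast
  have "reach (edges g) {y} a x" using g A a by (intro biconnected_reach) auto
  from reach_closed[OF this a] have "x \<in> A"
    using N no by (fastforce simp: insert_commute)
  with A show False by simp
qed

lemma separating_pair_iff: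
  "separating_pair g x y \<longleftrightarrow> x \<noteq> y \<and> x \<in> verts g \<and> y \<in> verts g \<and>
     (\<exists>a\<in>verts g - {x, y}. \<exists>b\<in>verts g - {x, y}. \<not> reach (edges g) {x, y} a b)"
  by (simp add: separating_pair_def connected_delete_iff)

lemma separating_pair_commute: "separating_pair g x y \<longleftrightarrow> separating_pair g y x"
  by (auto simp: separating_pair_def insert_commute)

section \<open>Classes left by a separating pair, and the pieces built on them\<close>

locale cut =
  fixes h :: "'v ugraph" and x y :: 'v
  assumes bic: "biconnected h" and sep: "separating_pair h x y"
begin

abbreviation "E \<equiv> edges h"
abbreviation "cl \<equiv> connected_classes (delete_verts h {x, y})"

definition piece :: "'v set \<Rightarrow> 'v ugraph" where
  "piece K = UGraph (K \<union> {x, y}) (insert {x, y} {e \<in> E. e \<subseteq> K \<union> {x, y}})"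

lemma verts_piece [simp]: "verts (piece K) = K \<union> {x, y}"
  and edges_piece: "edges (piece K) = insert {x, y} {e \<in> E. e \<subseteq> K \<union> {x, y}}"
  by (simp_all add: piece_def)

lemma pieces_eq: "pieces h x y = piece ` cl"
  by (simp add: pieces_def piece_def)

lemma xy: "x \<noteq> y" "x \<in> verts h" "y \<in> verts h"
  using sep by (auto simp: separating_pair_def)

lemma classE:
  assumes "K \<in> cl"
  obtains a where "a \<in> verts h - {x, y}" "K = {v \<in> verts h - {x, y}. reach E {x, y} a v}"
  using assms unfolding connected_classes_delete by blast

lemma class_subset: "K \<in> cl \<Longrightarrow> K \<subseteq> verts h - {x, y}"
  by (elim classE) blast

lemma class_nonempty: "K \<in> cl \<Longrightarrow> K \<noteq> {}"
  by (elim classE) force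

lemma class_reach:
  assumes "K \<in> cl" "k \<in> K" "l \<in> K"
  shows "reach E {x, y} k l"
proof -
  obtain a where "K = {v \<in> verts h - {x, y}. reach E {x, y} a v}" using assms by (elim classE)
  then have "reach E {x, y} a k" "reach E {x, y} a l" using assms by auto
  then show ?thesis using reach_sym reach_trans by metis
qed

lemma class_reachD:
  assumes "K \<in> cl" "k \<in> K" "l \<in> verts h - {x, y}" "reach E {x, y} k l"
  shows "l \<in> K"
proof -
  obtain a where a: "K = {v \<in> verts h - {x, y}. reach E {x, y} a v}" using assms by (elim classE)
  then have "reach E {x, y} a l" using assms by (auto intro: reach_trans)
  then show ?thesis using assms a by simp
qed

lemma class_neighbours:
  assumes "K \<in> cl" "k \<in> K" "{k, w} \<in> E"
  shows "w \<in> K \<union> {x, y}"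
proof (rule ccontr)
  assume "w \<notin> K \<union> {x, y}"
  moreover have "k \<notin> {x, y}" using class_subset[OF assms(1)] assms(2) by blast
  moreover have "w \<in> verts h" using simple_edge[OF biconnectedD(1)[OF bic] assms(3)] by blast
  ultimately show False
    using class_reachD[OF assms(1,2), of w] reach_edge[OF assms(3), of "{x, y}"] by blast
qed

lemma class_edge:
  assumes "K \<in> cl" "e \<in> E" "e \<inter> K \<noteq> {}"
  shows "e \<subseteq> K \<union> {x, y}"
proof -
  obtain u v where e: "e = {u, v}"
    using assms(2) biconnectedD(1)[OF bic] by (auto simp: simple_graph_def card_2_iff)
  then have "{u, v} \<in> E" "{v, u} \<in> E" "u \<in> K \<or> v \<in> K"
    using assms by (auto simp: insert_commute)
  then show ?thesis using class_neighbours[OF assms(1)] unfolding e by blast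
qed

lemma class_disjoint:
  assumes "K \<in> cl" "K' \<in> cl" "K \<noteq> K'"
  shows "K \<inter> K' = {}"
proof (rule ccontr)
  assume "K \<inter> K' \<noteq> {}"
  then obtain v where v: "v \<in> K" "v \<in> K'" by blast
  have "w \<in> B" if "A \<in> cl" "B \<in> cl" "v \<in> A" "v \<in> B" "w \<in> A" for w A B
    using class_reachD[OF that(2,4)] class_reach[OF that(1,3,5)] class_subset[OF that(1)] that(5) by blast
  then show False using assms v by blast
qed

lemma class_cover: "v \<in> verts h \<Longrightarrow> v \<notin> {x, y} \<Longrightarrow> \<exists>K\<in>cl. v \<in> K"
  unfolding connected_classes_delete
  by (intro bexI[of _ "{w \<in> verts h - {x, y}. reach E {x, y} v w}"]) auto

lemma class_other: "K \<in> cl \<Longrightarrow> \<exists>K'\<in>cl. K' \<noteq> K"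
proof (rule ccontr)
  assume K: "K \<in> cl" "\<not> (\<exists>K'\<in>cl. K' \<noteq> K)"
  then have "verts h - {x, y} \<subseteq> K" using class_cover by blast
  then have "\<forall>a\<in>verts h - {x, y}. \<forall>b\<in>verts h - {x, y}. reach E {x, y} a b"
    using class_reach[OF K(1)] by blast
  then show False using sep unfolding separating_pair_iff by blast
qed

lemma class_neighbour_ends:
  assumes "K \<in> cl"
  shows "\<exists>k\<in>K. {x, k} \<in> E" "\<exists>k\<in>K. {y, k} \<in> E"
proof -
  have K: "K \<subseteq> verts h" "x \<notin> K" "y \<notin> K" using class_subset[OF assms] by auto
  show "\<exists>k\<in>K. {x, k} \<in> E"
    by (rule biconnected_neighbour[OF bic class_nonempty[OF assms], of x y])
      (use K xy class_neighbours[OF assms] in auto)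
  show "\<exists>k\<in>K. {y, k} \<in> E"
    by (rule biconnected_neighbour[OF bic class_nonempty[OF assms], of y x])
      (use K xy class_neighbours[OF assms] in auto)
qed

text \<open>A walk inside a class uses only edges meeting the class, so it survives in any edge set
  \<open>E'\<close> that keeps these. The freedom in \<open>E'\<close> permits the later removal of
  a single edge elsewhere.\<close>

lemma class_inner:
  assumes K: "K \<in> cl" and kl: "k \<in> K" "l \<in> K" and S: "S \<inter> K = {}"
    and E': "\<And>e. e \<in> E \<Longrightarrow> e \<inter> K \<noteq> {} \<Longrightarrow> e \<in> E'"
  shows "reach E' S k l"
proof -
  have "l \<in> {w \<in> K. reach E' S k w}"
  proof (rule reach_closed[OF class_reach[OF K kl]])
    fix u v assume u: "u \<in> {w \<in> K. reach E' S k w}" and e: "{u, v} \<in> E" "v \<notin> {x, y}"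
    then have "v \<in> K" using class_neighbours[OF K] by blast
    moreover from this have "reach E' S u v" using u e E' S by (intro reach_edge) auto
    ultimately show "v \<in> {w \<in> K. reach E' S k w}" using u reach_trans[of E' S k u v] by blast
  qed (use kl in auto)
  then show ?thesis by simp
qed

lemma class_to_end:
  assumes K: "K \<in> cl" and k: "k \<in> K" and S: "S \<inter> K = {}" and z: "z \<in> {x, y}" "z \<notin> S"
    and E': "\<And>e. e \<in> E \<Longrightarrow> e \<inter> K \<noteq> {} \<Longrightarrow> e \<in> E'"
  shows "reach E' S k z"
proof -
  obtain l where l: "l \<in> K" "{l, z} \<in> E"
    using class_neighbour_ends[OF K] z(1) by (auto simp: insert_commute)
  have "reach E' S k l" by (rule class_inner[OF K k l(1) S E'])
  moreover have "reach E' S l z" using l z S by (intro reach_edge E') auto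
  ultimately show ?thesis by (rule reach_trans)
qed

lemma class_across:
  assumes K: "K \<in> cl" and S: "S \<inter> (K \<union> {x, y}) = {}"
    and E': "\<And>e. e \<in> E \<Longrightarrow> e \<inter> K \<noteq> {} \<Longrightarrow> e \<in> E'"
  shows "reach E' S x y"
proof -
  obtain k where k: "k \<in> K" using class_nonempty[OF K] by blast
  have "reach E' S k x" "reach E' S k y" using S by (auto intro!: class_to_end[OF K k _ _ _ E'])
  then show ?thesis using reach_sym[of E' S k x] reach_trans[of E' S x k y] by blast
qed

lemma piece_project:
  assumes "K \<in> cl" "reach E' S s t" "s \<in> K \<union> {x, y}" "t \<in> K \<union> {x, y}" "E' \<subseteq> E"
  shows "reach (insert {x, y} {e \<in> E'. e \<subseteq> K \<union> {x, y}}) S s t"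
  using assms class_edge by (intro reach_project) blast+

text \<open>The detour that stands for the reinserted edge runs through another class, which exists
  because the pair separates.\<close>

lemma piece_across:
  assumes "K \<in> cl" "S \<subseteq> K" 
    and E': "\<And>e. e \<in> E \<Longrightarrow> \<not> e \<subseteq> K \<union> {x, y} \<Longrightarrow> e \<in> E'"
  shows "reach E' S x y"
proof -
  obtain K' where K': "K' \<in> cl" "K' \<noteq> K" using class_other assms(1) by blast
  show ?thesis
  proof (rule class_across[OF K'(1)])
    show "S \<inter> (K' \<union> {x, y}) = {}"
      using class_disjoint[OF assms(1) K'(1)] K'(2) class_subset[OF assms(1)] assms(2) by blast
    fix e assume "e \<in> E" "e \<inter> K' \<noteq> {}"
    then show "e \<in> E'"
      using E' class_disjoint[OF assms(1) K'(1)] K'(2) class_subset[OF K'(1)] by blast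
  qed
qed

text \<open>The bound on \<open>S\<close> keeps the detour through another class free of forbidden
  vertices. Only the lifting half relies on it; \<open>piece_reach\<close> is the projecting half
  for arbitrary \<open>S\<close>.\<close>

lemma piece_reach_iff:
  assumes "K \<in> cl" "S \<subseteq> K \<union> {x, y}" "s \<in> K \<union> {x, y}" "t \<in> K \<union> {x, y}"
  shows "reach (edges (piece K)) S s t \<longleftrightarrow> reach E S s t"
proof
  assume "reach (edges (piece K)) S s t"
  then show "reach E S s t" unfolding edges_piece
    by (rule reach_lift) (use assms in \<open>auto intro: piece_across[OF assms(1)]\<close>)
next
  assume "reach E S s t"
  then show "reach (edges (piece K)) S s t" unfolding edges_piece
    using assms by (intro piece_project) auto
qed

lemma piece_reach:
  assumes "K \<in> cl" "reach E S s t" "s \<in> K \<union> {x, y}" "t \<in> K \<union> {x, y}"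
  shows "reach (edges (piece K)) S s t"
  unfolding edges_piece using assms by (intro piece_project) auto

lemma finite_class: "K \<in> cl \<Longrightarrow> finite K"
  using class_subset biconnectedD(2)[OF bic] by (metis finite_Diff finite_subset)

lemma piece_biconnected:
  assumes K: "K \<in> cl"
  shows "biconnected (piece K)"
proof (rule biconnectedI)
  show "simple_graph (piece K)"
    using finite_class[OF K] biconnectedD(1)[OF bic] xy
    by (auto simp: simple_graph_def edges_piece)
  have "card (K \<union> {x, y}) = card K + 2"
    using finite_class[OF K] class_subset[OF K] xy by (subst card_Un_disjoint) auto
  then show "2 < card (verts (piece K))"
    using class_nonempty[OF K] finite_class[OF K] by (simp add: card_gt_0_iff)
  fix z a b assume ab: "a \<in> verts (piece K) - {z}" "b \<in> verts (piece K) - {z}"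
  then have "reach E {z} a b"
    using class_subset[OF K] xy by (intro biconnected_reach[OF bic]) auto
  then show "reach (edges (piece K)) {z} a b" using ab by (intro piece_reach[OF K]) auto
qed

lemma piece_card_less:
  assumes K: "K \<in> cl"
  shows "card (verts (piece K)) < card (verts h)"
proof (rule psubset_card_mono)
  obtain K' where "K' \<in> cl" "K' \<noteq> K" using class_other[OF K] by blast
  then have "K' \<noteq> {}" "K' \<subseteq> verts h - {x, y}" "K \<inter> K' = {}"
    using K class_nonempty class_subset class_disjoint by blast+
  then show "verts (piece K) \<subset> verts h" using class_subset[OF K] xy by auto
qed (rule biconnectedD(2)[OF bic])

lemma piece_not_separating:
  assumes K: "K \<in> cl"
  shows "\<not> separating_pair (piece K) x y" "\<not> separating_pair (piece K) y x"
proof -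
  show "\<not> separating_pair (piece K) x y"
    using class_reach[OF K] piece_reach[OF K] class_subset[OF K] unfolding separating_pair_iff by auto
  then show "\<not> separating_pair (piece K) y x" by (simp add: separating_pair_commute)
qed

lemma piece_inj: "K \<in> cl \<Longrightarrow> K' \<in> cl \<Longrightarrow> piece K = piece K' \<Longrightarrow> K = K'"
  using class_subset[of K] class_subset[of K'] unfolding piece_def by auto

lemma finite_classes: "finite cl"
  using biconnectedD(2)[OF bic] by (simp add: connected_classes_delete)

lemma finite_pieces: "finite (pieces h x y)"
  using finite_classes by (simp add: pieces_eq)

lemma pieceE:
  assumes "p \<in> pieces h x y"
  obtains K where "K \<in> cl" "p = piece K"
  using assms unfolding pieces_eq by blast

lemma pieces_inter: "p \<in> pieces h x y \<Longrightarrow> q \<in> pieces h x y \<Longrightarrow> p \<noteq> q \<Longrightarrow> verts p \<inter> verts q = {x, y}"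
  using class_disjoint by (elim pieceE) auto

lemma pieces_biconnected: "p \<in> pieces h x y \<Longrightarrow> biconnected p"
  by (elim pieceE) (simp add: piece_biconnected)

lemma pieces_ends: "p \<in> pieces h x y \<Longrightarrow> x \<in> verts p \<and> y \<in> verts p \<and> {x, y} \<in> edges p"
  by (elim pieceE) (simp add: edges_piece)

lemma pieces_subset: "p \<in> pieces h x y \<Longrightarrow> verts p \<subseteq> verts h"
  using class_subset xy by (elim pieceE) auto

lemma pieces_edges: "p \<in> pieces h x y \<Longrightarrow> edges p = insert {x, y} {e \<in> E. e \<subseteq> verts p}"
  by (elim pieceE) (simp add: edges_piece)

lemma pieces_edgeD:
  "p \<in> pieces h x y \<Longrightarrow> e \<in> edges p \<Longrightarrow> e \<noteq> {x, y} \<Longrightarrow> e \<in> E \<and> e \<subseteq> verts p"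
  using pieces_edges[of p] by simp

lemma pieces_cover_edge:
  assumes "e \<in> E"
  shows "\<exists>p\<in>pieces h x y. e \<subseteq> verts p"
proof (cases "e \<subseteq> {x, y}")
  case True
  have "cl \<noteq> {}" using sep unfolding separating_pair_iff connected_classes_delete by blast
  then show ?thesis using True by (auto simp: pieces_eq)
next
  case False
  moreover have "e \<subseteq> verts h" using assms biconnectedD(1)[OF bic] by (simp add: simple_graph_def)
  ultimately obtain v where "v \<in> e" "v \<in> verts h" "v \<notin> {x, y}" by auto
  then obtain K where "K \<in> cl" "v \<in> K" using class_cover by blast
  then have "e \<subseteq> K \<union> {x, y}" using \<open>v \<in> e\<close> assms by (intro class_edge) auto
  then show ?thesis using \<open>K \<in> cl\<close>
    by (intro bexI[of _ "piece K"]) (simp_all add: pieces_eq)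
qed

lemma pieces_reach_iff:
  "p \<in> pieces h x y \<Longrightarrow> S \<subseteq> verts p \<Longrightarrow> s \<in> verts p \<Longrightarrow> t \<in> verts p \<Longrightarrow>
    reach (edges p) S s t \<longleftrightarrow> reach E S s t"
  by (elim pieceE) (simp add: piece_reach_iff)

lemma pieces_reach:
  "p \<in> pieces h x y \<Longrightarrow> reach E S s t \<Longrightarrow> s \<in> verts p \<Longrightarrow> t \<in> verts p \<Longrightarrow> reach (edges p) S s t"
  by (elim pieceE) (simp add: piece_reach)

text \<open>Separation passes up because a piece and \<open>h\<close> agree on reachability between
  vertices of the piece. The pair \<open>{x, y}\<close> itself is excluded, since deleting it from a
  piece leaves one connected class.\<close>

lemma pieces_separating:
  assumes p: "p \<in> pieces h x y" and "separating_pair p u v"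
  shows "separating_pair h u v" "{u, v} \<noteq> {x, y}"
proof -
  from assms(2) obtain a b where ab: "u \<noteq> v" "u \<in> verts p" "v \<in> verts p" "a \<in> verts p - {u, v}"
      "b \<in> verts p - {u, v}" "\<not> reach (edges p) {u, v} a b"
    unfolding separating_pair_iff by blast
  then have "\<not> reach E {u, v} a b" using pieces_reach_iff[OF p, of "{u, v}"] by simp
  then show "separating_pair h u v"
    using ab pieces_subset[OF p] unfolding separating_pair_iff by blast
  show "{u, v} \<noteq> {x, y}"
    using assms piece_not_separating by (elim pieceE) (auto simp: doubleton_eq_iff)
qed

end

subsection \<open>Polygons\<close>

fun path_edges :: "'v list \<Rightarrow> 'v set set" where
  "path_edges (a # b # r) = insert {a, b} (path_edges (b # r))"
| "path_edges _ = {}"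

lemma path_edges_append:
  "A \<noteq> [] \<Longrightarrow> B \<noteq> [] \<Longrightarrow>
    path_edges (A @ B) = insert {last A, hd B} (path_edges A \<union> path_edges B)"
proof (induction A rule: path_edges.induct)
  case ("2_2" v)
  then show ?case by (cases B) auto
qed auto

lemma path_edges_subset: "e \<in> path_edges L \<Longrightarrow> e \<subseteq> set L"
  by (induction L rule: path_edges.induct) auto

lemma path_edges_nth: "path_edges vs = {{vs ! i, vs ! Suc i} | i. Suc i < length vs}"
proof (induction vs rule: path_edges.induct)
  case (1 a b r)
  have "{{(a # b # r) ! i, (a # b # r) ! Suc i} | i. Suc i < length (a # b # r)} =
      insert {a, b} {{(b # r) ! i, (b # r) ! Suc i} | i. Suc i < length (b # r)}" (is "?l = ?r")
  proof
    show "?l \<subseteq> ?r"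
    proof
      fix e assume "e \<in> ?l"
      then obtain i where "e = {(a # b # r) ! i, (a # b # r) ! Suc i}" "Suc i < length (a # b # r)"
        by blast
      then show "e \<in> ?r" by (cases i) auto
    qed
    show "?r \<subseteq> ?l"
    proof
      fix e assume "e \<in> ?r"
      then consider "e = {a, b}" | i where "e = {(b # r) ! i, (b # r) ! Suc i}" "Suc i < length (b # r)"
        by blast
      then show "e \<in> ?l"
      proof cases
        case 1
        then show ?thesis by (intro CollectI exI[of _ 0]) auto
      next
        case (2 i)
        then show ?thesis by (intro CollectI exI[of _ "Suc i"]) auto
      qed
    qed
  qed
  then show ?case using 1 by simp
qed auto

definition cycle_edges :: "'v list \<Rightarrow> 'v set set" where
  "cycle_edges vs = insert {last vs, hd vs} (path_edges vs)"

lemma cycle_edges_nth: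
  assumes "vs \<noteq> []"
  shows "{{vs ! i, vs ! (Suc i mod length vs)} | i. i < length vs} = cycle_edges vs" (is "?l = ?r")
proof -
  let ?f = "\<lambda>i. {vs ! i, vs ! (Suc i mod length vs)}"
  obtain n where n: "length vs = Suc n" using assms by (cases vs) auto
  have "?l = ?f ` {..<Suc n}" unfolding n by blast
  also have "\<dots> = insert (?f n) (?f ` {..<n})" by (simp add: lessThan_Suc)
  also have "?f n = {last vs, hd vs}" using assms n by (simp add: last_conv_nth hd_conv_nth)
  also have "?f ` {..<n} = path_edges vs" unfolding path_edges_nth n by (auto simp: n)
  finally show ?thesis by (simp add: cycle_edges_def)
qed

lemma polygon_iff:
  "polygon g \<longleftrightarrow> (\<exists>vs. distinct vs \<and> 3 \<le> length vs \<and> g = UGraph (set vs) (cycle_edges vs))"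
proof -
  have eq: "3 \<le> length vs \<Longrightarrow>
      {{vs ! i, vs ! (Suc i mod length vs)} | i. i < length vs} = cycle_edges vs" for vs :: "'a list"
    by (rule cycle_edges_nth) auto
  show ?thesis unfolding polygon_def by (intro ex_cong1 conj_cong refl) (simp add: eq)
qed

lemma polygon_rotate:
  assumes "polygon g" "x \<in> verts g"
  obtains L where "distinct (x # L)" "2 \<le> length L" "g = UGraph (set (x # L)) (cycle_edges (x # L))"
proof -
  obtain vs where vs: "distinct vs" "3 \<le> length vs" "g = UGraph (set vs) (cycle_edges vs)"
    using assms(1) unfolding polygon_iff by blast
  obtain A B where AB: "vs = A @ x # B" using assms(2) vs split_list[of x vs] by auto
  show thesis
  proof (rule that)
    have "cycle_edges (A @ x # B) = cycle_edges (x # B @ A)"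
    proof (cases "A = []")
      case False
      then show ?thesis
        using path_edges_append[of A "x # B"] path_edges_append[of "x # B" A]
        by (auto simp: cycle_edges_def)
    qed simp
    then show "g = UGraph (set (x # B @ A)) (cycle_edges (x # B @ A))" using vs AB by auto
  qed (use vs AB in auto)
qed

lemma cycle_edges_neighbour:
  assumes "distinct (x # L)" "L \<noteq> []" "{x, w} \<in> cycle_edges (x # L)"
  shows "w = hd L \<or> w = last L"
proof -
  obtain b r where L: "L = b # r" using assms(2) by (cases L) auto
  show ?thesis using assms path_edges_subset[of "{x, w}" L] by (auto simp: L cycle_edges_def doubleton_eq_iff)
qed

lemma path_reach:
  assumes "path_edges L \<subseteq> E" "set L \<inter> S = {}" "a \<in> set L" "b \<in> set L"
  shows "reach E S a b"
proof -
  have *: "c \<in> set L \<Longrightarrow> path_edges L \<subseteq> E \<Longrightarrow> set L \<inter> S = {} \<Longrightarrow> reach E S (hd L) c" for c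
  proof (induction L rule: path_edges.induct)
    case (1 a b r)
    show ?case
    proof (cases "c = a")
      case False
      then have "reach E S b c" using 1 by auto
      moreover have "reach E S a b" using 1 by (intro reach_edge) auto
      ultimately show ?thesis using reach_trans[of E S a b c] by simp
    qed simp
  qed auto
  show ?thesis
    by (rule reach_trans[OF reach_sym]) (rule *[OF assms(3,1,2)], rule *[OF assms(4,1,2)])
qed

text \<open>The vertex \<open>u\<close> is the other neighbour of \<open>x\<close> on the cycle:
  without \<open>u\<close> and without the edge to \<open>y\<close>, the vertex \<open>x\<close> is
  isolated.\<close>

lemma polygon_edge_cut:
  assumes "polygon g" "{x, y} \<in> edges g" "x \<noteq> y" "x \<in> verts g"
  obtains u where "u \<in> verts g - {x, y}" "\<not> reach (edges g - {{x, y}}) {u} x y"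
proof -
  obtain L where L: "distinct (x # L)" "2 \<le> length L" "g = UGraph (set (x # L)) (cycle_edges (x # L))"
    using polygon_rotate[OF assms(1,4)] by blast
  then have ne: "L \<noteq> []" by auto
  have neq: "hd L \<noteq> last L"
    using L(1,2) by (cases L) auto
  have y: "y = hd L \<or> y = last L"
    using cycle_edges_neighbour[OF L(1) ne, of y] assms(2) L(3) by simp
  define u where "u = (if y = hd L then last L else hd L)"
  have u: "u \<in> set L" "u \<noteq> y" using ne neq y by (auto simp: u_def)
  have "w = y \<or> w = u" if "{x, w} \<in> edges g" for w
    using cycle_edges_neighbour[OF L(1) ne, of w] that L(3) y by (auto simp: u_def)
  then have "y \<in> {x}" if "reach (edges g - {{x, y}}) {u} x y"
    by (intro reach_closed[OF that]) auto
  then show thesis using u L assms(3) by (intro that[of u]) auto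
qed

text \<open>Deleting \<open>u\<close> and \<open>v\<close> separates \<open>x\<close> from
  \<open>y\<close>. That \<open>u\<close> and \<open>v\<close> are distinct vertices of the graph is
  not demanded; in a 2-connected graph it follows for distinct vertices \<open>x\<close> and
  \<open>y\<close>.\<close>

definition crossed :: "'v set set \<Rightarrow> 'v \<Rightarrow> 'v \<Rightarrow> bool" where
  "crossed E x y \<longleftrightarrow> (\<exists>u v. {u, v} \<inter> {x, y} = {} \<and> \<not> reach E {u, v} x y)"

lemma crossedI:
  "u \<notin> {x, y} \<Longrightarrow> v \<notin> {x, y} \<Longrightarrow> \<not> reach E {u, v} x y \<Longrightarrow> crossed E x y"
  unfolding crossed_def by (intro exI[of _ u] exI[of _ v]) auto

lemma crossed_commute: "crossed E x y \<longleftrightarrow> crossed E y x"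
  unfolding crossed_def by (metis insert_commute reach_sym)

text \<open>The two neighbours of \<open>x\<close> cut it off from \<open>y\<close>. They differ
  from \<open>y\<close>, because deleting two adjacent vertices of a polygon leaves a path, which is
  connected.\<close>

lemma polygon_separating_pair_crossed:
  assumes "polygon g" "separating_pair g x y"
  shows "crossed (edges g) x y"
proof -
  have xy: "x \<noteq> y" "x \<in> verts g" "y \<in> verts g" using assms(2) by (auto simp: separating_pair_def)
  obtain L where L: "distinct (x # L)" "2 \<le> length L" "g = UGraph (set (x # L)) (cycle_edges (x # L))"
    using polygon_rotate[OF assms(1) xy(2)] by blast
  then have ne: "L \<noteq> []" by auto
  have no: False if B: "verts g - {x, y} = set B" "path_edges B \<subseteq> edges g" for B
  proof -
    have "reach (edges g) {x, y} a b" if "a \<in> verts g - {x, y}" "b \<in> verts g - {x, y}" for a b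
      using B that by (intro path_reach[of B]) auto
    then show False using assms(2) unfolding separating_pair_iff by blast
  qed
  have "y \<noteq> hd L"
  proof
    assume "y = hd L"
    then obtain B where B: "L = y # B" using ne by (cases L) auto
    show False
    proof (rule no)
      show "verts g - {x, y} = set B" using L B by auto
      show "path_edges B \<subseteq> edges g" using L B by (cases B) (auto simp: cycle_edges_def)
    qed
  qed
  moreover have "y \<noteq> last L"
  proof
    assume "y = last L"
    then obtain B where B: "L = B @ [y]" using ne by (metis append_butlast_last_id)
    show False
    proof (rule no)
      show "verts g - {x, y} = set B" using L B by auto
      show "path_edges B \<subseteq> edges g"
        using L B path_edges_append[of "x # B" "[y]"] by (cases B) (auto simp: cycle_edges_def)
    qed
  qed
  moreover have "y \<in> {x}" if "reach (edges g) {hd L, last L} x y"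
    using cycle_edges_neighbour[OF L(1) ne] L(3) by (intro reach_closed[OF that]) auto
  ultimately show ?thesis
    using L(1) ne xy unfolding crossed_def by (intro exI[of _ "hd L"] exI[of _ "last L"]) auto
qed

text \<open>Being 3-connected requires more than three vertices, so this smallest case must be
  recognised as a polygon: two non-adjacent vertices would be separated by the third.\<close>

lemma triangle:
  assumes "biconnected g" "card (verts g) = 3"
  shows "polygon g"
proof -
  obtain a b c where abc: "verts g = {a, b, c}" "a \<noteq> b" "a \<noteq> c" "b \<noteq> c"
    using assms(2) by (auto simp: card_3_iff)
  have *: "{s, t} \<in> edges g" if "verts g = {s, t, r}" "s \<noteq> t" "s \<noteq> r" "t \<noteq> r" for s t r
  proof (rule ccontr)
    assume no: "{s, t} \<notin> edges g"
    have "reach (edges g) {r} s t" using that by (intro biconnected_reach[OF assms(1)]) auto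
    then have "t \<in> {s}"
    proof (rule reach_closed)
      fix u v assume "u \<in> {s}" "{u, v} \<in> edges g" "v \<notin> {r}"
      then show "v \<in> {s}"
        using no that simple_edge[OF biconnectedD(1)[OF assms(1)], of u v] by auto
    qed simp
    then show False using that by simp
  qed
  have "edges g = {{a, b}, {b, c}, {c, a}}"
  proof
    show "{{a, b}, {b, c}, {c, a}} \<subseteq> edges g"
      using *[of a b c] *[of b c a] *[of c a b] abc by (simp add: insert_commute)
    show "edges g \<subseteq> {{a, b}, {b, c}, {c, a}}"
    proof
      fix e assume "e \<in> edges g"
      then obtain s t where "e = {s, t}" "s \<noteq> t" "s \<in> {a, b, c}" "t \<in> {a, b, c}"
        using biconnectedD(1)[OF assms(1)] abc by (auto simp: simple_graph_def card_2_iff)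
      then show "e \<in> {{a, b}, {b, c}, {c, a}}" by (auto simp: insert_commute)
    qed
  qed
  then have "g = UGraph (set [a, b, c]) (cycle_edges [a, b, c])"
    using abc by (cases g) (auto simp: cycle_edges_def)
  then show ?thesis unfolding polygon_iff using abc by (intro exI[of _ "[a, b, c]"]) simp
qed

section \<open>Graphs all of whose separating pairs are crossed\<close>

context
  fixes g :: "'v ugraph"
  assumes bic: "biconnected g"
    and crossed: "\<And>x y. separating_pair g x y \<Longrightarrow> crossed (edges g) x y"
begin

text \<open>A pair \<open>{u, v}\<close> crossing \<open>{x, y}\<close> has one member \<open>u\<close> in \<open>A\<close>, and \<open>A - {u}\<close> falls
  into a part attached to \<open>{x, u}\<close> and a part attached to \<open>{u, y}\<close>.\<close>

lemma segment_path:
  assumes "A \<subseteq> verts g" "x \<in> verts g" "y \<in> verts g" "x \<notin> A" "y \<notin> A" "x \<noteq> y"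
    and "\<And>a w. a \<in> A \<Longrightarrow> {a, w} \<in> edges g \<Longrightarrow> w \<in> A \<union> {x, y}"
    and "z \<in> verts g" "z \<notin> A \<union> {x, y}"
    and "A = {} \<Longrightarrow> {x, y} \<in> edges g"
  shows "\<exists>L. distinct L \<and> set L = A \<and> {e \<in> edges g. e \<subseteq> A \<union> {x, y}} = path_edges (x # L @ [y])"
  using assms
proof (induction "card A" arbitrary: A x y z rule: less_induct)
  case less
  note N = less.prems(7) and A = less.prems(1-6) and z = less.prems(8,9)
  have simple: "simple_graph g" and finV: "finite (verts g)" by (rule biconnectedD[OF bic])+
  have edge: "\<exists>s t. e = {s, t} \<and> s \<noteq> t" if "e \<in> edges g" for e
    using that simple by (auto simp: simple_graph_def card_2_iff)
  show ?case
  proof (cases "A = {}")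
    case True
    have "{e \<in> edges g. e \<subseteq> {x, y}} = {{x, y}}"
      using less.prems(10)[OF True] edge by fastforce
    then show ?thesis using True by (intro exI[of _ "[]"]) simp
  next
    case False
    then obtain a where a: "a \<in> A" by blast
    have "\<not> reach (edges g) {x, y} a w" if "w \<notin> A" for w
    proof
      assume "reach (edges g) {x, y} a w"
      then have "w \<in> A" by (rule reach_closed) (use a N in auto)
      with that show False by simp
    qed
    then have sep: "separating_pair g x y"
      unfolding separating_pair_iff using a z A by blast
    interpret cut g x y by (rule cut.intro[OF bic sep])
    obtain K where K: "K \<in> cl" "a \<in> K" using class_cover[of a] a A by blast
    have KA: "K \<subseteq> A"
      using class_reach[OF K] \<open>\<And>w. w \<notin> A \<Longrightarrow> \<not> reach (edges g) {x, y} a w\<close> by blast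
    obtain K' where K': "K' \<in> cl" "z \<in> K'" using class_cover[of z] z by blast
    have K'A: "w \<notin> A" if "w \<in> K'" for w
    proof
      assume w: "w \<in> A"
      have "z \<in> A" by (rule reach_closed[OF class_reach[OF K'(1) that K'(2)] w]) (use N in auto)
      with z show False by simp
    qed
    \<comment> \<open>A crossing pair must meet every class, as an untouched class would join
      \<open>x\<close> to \<open>y\<close>. The class \<open>K\<close> lies inside \<open>A\<close>
      and the class \<open>K'\<close> of \<open>z\<close> outside, so exactly one vertex of the pair
      is in \<open>A\<close>.\<close>
    obtain u v where uv: "{u, v} \<inter> {x, y} = {}" "\<not> reach (edges g) {u, v} x y" "u \<in> A" "v \<notin> A"
    proof -
      obtain u v where uv: "{u, v} \<inter> {x, y} = {}" "\<not> reach (edges g) {u, v} x y"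
        using crossed[OF sep] unfolding crossed_def by blast
      have "u \<in> K \<or> v \<in> K" using class_across[OF K(1), of "{u, v}" E] uv by blast
      moreover have "u \<in> K' \<or> v \<in> K'" using class_across[OF K'(1), of "{u, v}" E] uv by blast
      ultimately consider "u \<in> A" "v \<notin> A" | "v \<in> A" "u \<notin> A" using KA K'A by blast
      then show thesis
      proof cases
        case 1
        then show thesis using that uv by blast
      next
        case 2
        then show thesis using that[of v u] uv by (simp add: insert_commute)
      qed
    qed
    define A1 where "A1 = {w \<in> A - {u}. reach E {u, v} x w}"
    define A2 where "A2 = A - {u} - A1"
    have split: "A = A1 \<union> A2 \<union> {u}" "A1 \<inter> A2 = {}" "u \<notin> A1" "u \<notin> A2"
      using uv(3) by (auto simp: A1_def A2_def)
    have step: "w \<in> A1 \<union> {x, u}" if "s \<in> A1 \<union> {x}" "{s, w} \<in> E" "w \<in> A \<union> {x, y}" for s w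
    proof (cases "w = u \<or> w = x")
      case False
      have "reach E {u, v} x s" using that(1) by (auto simp: A1_def)
      moreover have "reach E {u, v} s w"
        using that False uv A by (intro reach_edge) (auto simp: A1_def)
      ultimately have "reach E {u, v} x w" by (rule reach_trans)
      then show ?thesis using that(3) uv(2) False by (auto simp: A1_def)
    qed auto
    have step2: "w \<in> A2 \<union> {y, u}" if "s \<in> A2 \<union> {y}" "{s, w} \<in> E" "w \<in> A \<union> {x, y}" for s w
    proof (rule ccontr)
      assume "w \<notin> A2 \<union> {y, u}"
      then have "w \<in> A1 \<union> {x}" using that(3) split by blast
      moreover have "{w, s} \<in> E" using that(2) by (simp add: insert_commute)
      ultimately have "s \<in> A1 \<union> {x, u}" using step[of w s] that(1) split by blast
      then show False using that(1) split A uv(1) by blast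
    qed
    have x: "\<exists>w\<in>A. {x, w} \<in> E" and y: "\<exists>w\<in>A. {y, w} \<in> E"
    proof -
      show "\<exists>w\<in>A. {x, w} \<in> E"
        by (rule biconnected_neighbour[OF bic False A(1), of x y]) (use A N in auto)
      show "\<exists>w\<in>A. {y, w} \<in> E"
        by (rule biconnected_neighbour[OF bic False A(1), of y x]) (use A N in auto)
    qed
    have fin: "finite A" using A(1) finV by (rule finite_subset)
    have "\<exists>L. distinct L \<and> set L = A1 \<and> {e \<in> E. e \<subseteq> A1 \<union> {x, u}} = path_edges (x # L @ [u])"
    proof (rule less.hyps)
      show "card A1 < card A" using split fin uv(3) by (intro psubset_card_mono) auto
      show "w \<in> A1 \<union> {x, u}" if "s \<in> A1" "{s, w} \<in> E" for s w
        using step[of s w] N[of s w] that split by blast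
      show "{x, u} \<in> E" if "A1 = {}"
      proof -
        obtain w where w: "w \<in> A" "{x, w} \<in> E" using x by blast
        then show ?thesis using step[of x w] that A by auto
      qed
      \<comment> \<open>The role of the outside vertex \<open>z\<close> passes to the end that the
        shorter segment no longer has: \<open>y\<close> for \<open>A1\<close>, and \<open>x\<close>
        for \<open>A2\<close>.\<close>
      show "y \<in> verts g" "y \<notin> A1 \<union> {x, u}" using A split uv by auto
    qed (use A split uv in auto)
    moreover have "\<exists>L. distinct L \<and> set L = A2 \<and> {e \<in> E. e \<subseteq> A2 \<union> {u, y}} = path_edges (u # L @ [y])"
    proof (rule less.hyps)
      show "card A2 < card A" using split fin uv(3) by (intro psubset_card_mono) auto
      show "w \<in> A2 \<union> {u, y}" if "s \<in> A2" "{s, w} \<in> E" for s w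
        using step2[of s w] N[of s w] that split by blast
      show "{u, y} \<in> E" if "A2 = {}"
      proof -
        obtain w where w: "w \<in> A" "{y, w} \<in> E" using y by blast
        then show ?thesis using step2[of y w] that A by (auto simp: insert_commute)
      qed
      show "x \<in> verts g" "x \<notin> A2 \<union> {u, y}" using A split uv by auto
    qed (use A split uv in auto)
    ultimately obtain L1 L2 where L1: "distinct L1" "set L1 = A1"
        "{e \<in> E. e \<subseteq> A1 \<union> {x, u}} = path_edges (x # L1 @ [u])"
      and L2: "distinct L2" "set L2 = A2" "{e \<in> E. e \<subseteq> A2 \<union> {u, y}} = path_edges (u # L2 @ [y])"
      by blast
    have "{e \<in> E. e \<subseteq> A \<union> {x, y}} = {e \<in> E. e \<subseteq> A1 \<union> {x, u}} \<union> {e \<in> E. e \<subseteq> A2 \<union> {u, y}}"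
    proof (intro equalityI subsetI)
      fix e assume e: "e \<in> {e \<in> E. e \<subseteq> A \<union> {x, y}}"
      then obtain s t where st: "e = {s, t}" "{s, t} \<in> E" "{t, s} \<in> E" using edge[of e] by (auto simp: insert_commute)
      then have "s \<in> A \<union> {x, y}" "t \<in> A \<union> {x, y}" using e by auto
      then have "e \<subseteq> A1 \<union> {x, u} \<or> e \<subseteq> A2 \<union> {u, y}"
        using step[of s t] step[of t s] step2[of s t] step2[of t s] st split by blast
      then show "e \<in> {e \<in> E. e \<subseteq> A1 \<union> {x, u}} \<union> {e \<in> E. e \<subseteq> A2 \<union> {u, y}}" using e by blast
    qed (use split in auto)
    also have "\<dots> = path_edges (x # (L1 @ u # L2) @ [y])"
      unfolding L1(3) L2(3)
      using path_edges_append[of "x # L1" "u # L2 @ [y]"] path_edges_append[of "x # L1" "[u]"] by simp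
    finally show ?thesis using L1 L2 split by (intro exI[of _ "L1 @ u # L2"]) auto
  qed
qed

text \<open>One class and the union of all the others are both segments between \<open>x\<close> and
  \<open>y\<close>, each supplying the outside vertex for the other. Their two paths close up to a
  cycle.\<close>

lemma crossed_imp_polygon:
  assumes sep: "separating_pair g x y"
  shows "polygon g"
proof -
  interpret cut g x y by (rule cut.intro[OF bic sep])
  obtain a where "a \<in> verts g" "a \<notin> {x, y}" using sep unfolding separating_pair_iff by blast
  then obtain K where K: "K \<in> cl" using class_cover by blast
  obtain K' where K': "K' \<in> cl" "K' \<noteq> K" using class_other[OF K] by blast
  define B where "B = verts g - {x, y} - K"
  obtain k k' where k: "k \<in> K" "k' \<in> K'" using class_nonempty K K' by blast
  have KV: "K \<subseteq> verts g - {x, y}" using K by (rule class_subset)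
  have k': "k' \<in> B" using class_disjoint[OF K K'(1)] K' class_subset[OF K'(1)] k by (auto simp: B_def)
  have NB: "w \<in> B \<union> {x, y}" if "b \<in> B" "{b, w} \<in> E" for b w
    using class_neighbours[OF K, of w b] that simple_edge[OF biconnectedD(1)[OF bic] that(2)]
    by (auto simp: B_def insert_commute)
  have "\<exists>L. distinct L \<and> set L = K \<and> {e \<in> E. e \<subseteq> K \<union> {x, y}} = path_edges (x # L @ [y])"
    by (rule segment_path[of K x y k']) (use KV xy class_neighbours[OF K] k k' in \<open>auto simp: B_def\<close>)
  moreover have "\<exists>L. distinct L \<and> set L = B \<and> {e \<in> E. e \<subseteq> B \<union> {y, x}} = path_edges (y # L @ [x])"
    by (rule segment_path[of B y x k]) (use xy NB k k' KV in \<open>auto simp: B_def\<close>)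
  ultimately obtain L1 L2
    where L1: "distinct L1" "set L1 = K" "{e \<in> E. e \<subseteq> K \<union> {x, y}} = path_edges (x # L1 @ [y])"
      and L2: "distinct L2" "set L2 = B" "{e \<in> E. e \<subseteq> B \<union> {y, x}} = path_edges (y # L2 @ [x])"
    by blast
  have "E = {e \<in> E. e \<subseteq> K \<union> {x, y}} \<union> {e \<in> E. e \<subseteq> B \<union> {y, x}}"
  proof (intro equalityI subsetI)
    fix e assume e: "e \<in> E"
    then have "e \<subseteq> verts g" using biconnectedD(1)[OF bic] by (simp add: simple_graph_def)
    then show "e \<in> {e \<in> E. e \<subseteq> K \<union> {x, y}} \<union> {e \<in> E. e \<subseteq> B \<union> {y, x}}"
      using class_edge[OF K e] e by (auto simp: B_def)
  qed auto
  also have "\<dots> = cycle_edges (x # L1 @ y # L2)"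
    unfolding L1(3) L2(3) cycle_edges_def
    using path_edges_append[of "x # L1" "y # L2"] path_edges_append[of "x # L1" "[y]"]
      path_edges_append[of "y # L2" "[x]"] by auto
  finally have "E = cycle_edges (x # L1 @ y # L2)" .
  moreover have "verts g = set (x # L1 @ y # L2)" using L1 L2 KV xy by (auto simp: B_def)
  ultimately have "g = UGraph (set (x # L1 @ y # L2)) (cycle_edges (x # L1 @ y # L2))"
    by (cases g) auto
  moreover have "distinct (x # L1 @ y # L2)" using L1 L2 KV xy by (auto simp: B_def)
  moreover have "3 \<le> length (x # L1 @ y # L2)" using L1 k by (cases L1) auto
  ultimately show ?thesis unfolding polygon_iff by blast
qed

end

text \<open>Beyond three vertices, failure of 3-connectedness yields a disconnecting set of size
  two, smaller ones being excluded by 2-connectedness. If all such pairs were crossed, the graph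
  would be a polygon.\<close>

lemma splitting_cases:
  assumes "biconnected g"
  obtains "k_connected 3 g \<or> polygon g" | x y where "separating_pair g x y" "\<not> crossed (edges g) x y"
proof (cases "k_connected 3 g \<or> polygon g")
  case False
  have "card (verts g) \<noteq> 3" using triangle[OF assms] False by blast
  then have "3 < card (verts g)" using biconnectedD(3)[OF assms] by simp
  then obtain S where S: "S \<subseteq> verts g" "card S < 3" "\<not> connected_graph (delete_verts g S)"
    using False biconnectedD(1)[OF assms] unfolding k_connected_def by blast
  then have "card S = 2" using assms unfolding k_connected_def by (metis less_2_cases less_Suc_eq numeral_2_eq_2 numeral_3_eq_3)
  then obtain x y where "S = {x, y}" "x \<noteq> y" by (auto simp: card_2_iff)
  then have "separating_pair g x y" using S by (auto simp: separating_pair_def)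
  then show thesis using crossed_imp_polygon[OF assms] False that(2) by blast
qed (use that in blast)

subsection \<open>Properties of iterated splitting\<close>

lemma simple_edge_subset: "biconnected g \<Longrightarrow> e \<in> edges g \<Longrightarrow> e \<subseteq> verts g \<and> card e = 2"
  using biconnectedD(1)[of g] by (simp add: simple_graph_def)

locale splitting = cut h x y for h :: "'v ugraph" and x y :: 'v +
  fixes C :: "'v ugraph \<Rightarrow> 'v ugraph set" and D :: "'v ugraph \<Rightarrow> 'v set set"
  assumes parts: "p \<in> pieces h x y \<Longrightarrow> splits_into p (C p) (D p)"

text \<open>The rule passes 2-connectedness on to the pieces and presents each splitting step as an
  instance of the locale \<open>splitting\<close>, so that one interpretation gives access to all
  facts about pieces.\<close>

lemma splits_induct [consumes 2, case_names stop split]: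
  assumes "splits_into g C D" "biconnected g"
    and stop: "\<And>g. biconnected g \<Longrightarrow> k_connected 3 g \<or> polygon g \<Longrightarrow> P g {g} {}"
    and split: "\<And>g x y C D. splitting g x y C D \<Longrightarrow> (\<And>p. p \<in> pieces g x y \<Longrightarrow> P p (C p) (D p)) \<Longrightarrow>
      P g (\<Union>p\<in>pieces g x y. C p) (insert {x, y} (\<Union>p\<in>pieces g x y. D p))"
  shows "P g C D"
  using assms(1,2)
proof (induction rule: splits_into.induct)
  case (stop g)
  then show ?case by (rule assms(3)[rotated])
next
  case (split g x y C D)
  then interpret splitting g x y C D by unfold_locales auto
  show ?case
    by (rule assms(4)) (use split.IH pieces_biconnected in \<open>auto intro: splitting_axioms\<close>)
qed

lemma component_facts:
  assumes "splits_into g C D" "biconnected g" "c \<in> C"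
  shows "biconnected c" "verts c \<subseteq> verts g"
proof -
  have "\<forall>c\<in>C. biconnected c \<and> verts c \<subseteq> verts g"
    using assms(1,2)
  proof (induction rule: splits_induct)
    case (split g x y C D)
    interpret splitting g x y C D by (rule split.hyps)
    show ?case using split.IH pieces_subset by fastforce
  qed simp
  then show "biconnected c" "verts c \<subseteq> verts g" using assms by auto
qed

lemma finite_splits:
  assumes "splits_into g C D" "biconnected g"
  shows "finite C \<and> finite D"
  using assms
proof (induction rule: splits_induct)
  case (split g x y C D)
  interpret splitting g x y C D by (rule split.hyps)
  show ?case using split.IH finite_pieces by auto
qed simp

lemma bond_separating:
  assumes "splits_into g C D" "biconnected g" "b \<in> D"
  shows "\<exists>x y. b = {x, y} \<and> separating_pair g x y"
proof -
  have "\<forall>b\<in>D. \<exists>x y. b = {x, y} \<and> separating_pair g x y"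
    using assms(1,2)
  proof (induction rule: splits_induct)
    case (split g x y C D)
    interpret splitting g x y C D by (rule split.hyps)
    show ?case
    proof
      fix b assume "b \<in> insert {x, y} (\<Union> (D ` pieces g x y))"
      then consider "b = {x, y}" | p where "p \<in> pieces g x y" "b \<in> D p" by blast
      then show "\<exists>x y. b = {x, y} \<and> separating_pair g x y"
      proof cases
        case 1
        then show ?thesis using sep by blast
      next
        case (2 p)
        then obtain s t where "b = {s, t}" "separating_pair p s t" using split.IH by blast
        then show ?thesis using pieces_separating(1)[OF 2(1)] by blast
      qed
    qed
  qed simp
  then show ?thesis using assms(3) by blast
qed

lemma bond_subset:
  assumes "splits_into g C D" "biconnected g" "b \<in> D"
  shows "b \<subseteq> verts g" "card b = 2"
  using bond_separating[OF assms] by (auto simp: separating_pair_def)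

section \<open>How bonds and components are distributed over the pieces\<close>

context splitting
begin

lemma part_bond_neq:
  assumes "p \<in> pieces h x y" "b \<in> D p"
  shows "b \<noteq> {x, y}"
  using bond_separating[OF parts[OF assms(1)] pieces_biconnected[OF assms(1)] assms(2)]
    pieces_separating(2)[OF assms(1)] by blast

lemma part_bond_subset: "p \<in> pieces h x y \<Longrightarrow> b \<in> D p \<Longrightarrow> b \<subseteq> verts p"
  by (rule bond_subset(1)[OF parts pieces_biconnected])

lemma pair_eq_xy: "e \<subseteq> {x, y} \<Longrightarrow> card e = 2 \<Longrightarrow> e = {x, y}"
  using xy by (intro card_subset_eq) auto

lemma pieces_pair:
  assumes "p \<in> pieces h x y" "q \<in> pieces h x y" "e \<subseteq> verts p" "e \<subseteq> verts q" "card e = 2" "e \<noteq> {x, y}"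
  shows "p = q"
  using pair_eq_xy[of e] pieces_inter[OF assms(1,2)] assms by blast

lemma part_bond_in_one:
  assumes "p \<in> pieces h x y" "b \<in> D p" "q \<in> pieces h x y" "b \<subseteq> verts q"
  shows "q = p"
  using pieces_pair[OF assms(3,1,4)] part_bond_subset[OF assms(1,2)]
    bond_subset(2)[OF parts[OF assms(1)] pieces_biconnected[OF assms(1)] assms(2)]
    part_bond_neq[OF assms(1,2)] by blast

lemma part_component_subset: "p \<in> pieces h x y \<Longrightarrow> c \<in> C p \<Longrightarrow> verts c \<subseteq> verts p"
  by (rule component_facts(2)[OF parts pieces_biconnected])

lemma part_component_biconnected: "p \<in> pieces h x y \<Longrightarrow> c \<in> C p \<Longrightarrow> biconnected c"
  by (rule component_facts(1)[OF parts pieces_biconnected])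

lemma pieces_big:
  assumes "p \<in> pieces h x y" "q \<in> pieces h x y" "X \<subseteq> verts p" "X \<subseteq> verts q" "2 < card X"
  shows "p = q"
proof (rule ccontr)
  assume "p \<noteq> q"
  then have "X \<subseteq> {x, y}" using pieces_inter[OF assms(1,2)] assms by blast
  then have "card X \<le> card {x, y}" by (intro card_mono) auto
  then show False using assms(5) xy by simp
qed

lemma part_component_in_one:
  assumes "p \<in> pieces h x y" "c \<in> C p" "q \<in> pieces h x y" "verts c \<subseteq> verts q"
  shows "q = p"
  using pieces_big[OF assms(3,1,4)] part_component_subset[OF assms(1,2)]
    biconnectedD(3)[OF part_component_biconnected[OF assms(1,2)]] by blast

lemma part_component_edge_subset: "p \<in> pieces h x y \<Longrightarrow> c \<in> C p \<Longrightarrow> e \<in> edges c \<Longrightarrow> e \<subseteq> verts p \<and> card e = 2"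
  using simple_edge_subset[OF part_component_biconnected] part_component_subset by blast

text \<open>A component linked by \<open>b\<close> contains both vertices of \<open>b\<close>, which
  lie together in no piece but \<open>p\<close>. Thus a bond found inside a piece has the same
  neighbours there and in the whole graph.\<close>

lemma linked_part:
  assumes p: "p \<in> pieces h x y" and b: "b \<in> D p"
  shows "linked (\<Union>p\<in>pieces h x y. C p) b = linked (C p) b"
  using part_component_edge_subset part_bond_in_one[OF p b] p unfolding linked_def by blast

end

text \<open>Given \<open>g\<close> and its bonds, a component is thereby recovered from its vertex
  set alone, reinserted edges included.\<close>

lemma component_edges:
  assumes "splits_into g C D" "biconnected g"
  shows "\<forall>c\<in>C. edges c = {e \<in> edges g \<union> D. e \<subseteq> verts c}"
  using assms
proof (induction rule: splits_induct)
  case (stop g)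
  then show ?case using simple_edge_subset by auto
next
  case (split g x y C D)
  interpret splitting g x y C D by (rule split.hyps)
  show ?case
  proof
    fix c assume "c \<in> (\<Union>p\<in>pieces g x y. C p)"
    then obtain p where p: "p \<in> pieces g x y" "c \<in> C p" by blast
    have "edges c = {e \<in> insert {x, y} {e \<in> E. e \<subseteq> verts p} \<union> D p. e \<subseteq> verts c}"
      using split.IH[OF p(1)] p(2) pieces_edges[OF p(1)] by simp
    also have "\<dots> = {e \<in> E \<union> insert {x, y} (\<Union>p\<in>pieces g x y. D p). e \<subseteq> verts c}"
      using part_bond_in_one[OF _ _ p(1)] part_component_subset[OF p] p(1) by blast
    finally show "edges c = {e \<in> E \<union> insert {x, y} (\<Union>p\<in>pieces g x y. D p). e \<subseteq> verts c}" .
  qed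
qed

lemma edge_unique_component:
  assumes "splits_into g C D" "biconnected g"
  shows "\<forall>e\<in>edges g - D. \<exists>!c. c \<in> C \<and> e \<in> edges c"
  using assms
proof (induction rule: splits_induct)
  case (split g x y C D)
  interpret splitting g x y C D by (rule split.hyps)
  show ?case
  proof
    fix e assume e: "e \<in> E - insert {x, y} (\<Union>p\<in>pieces g x y. D p)"
    then obtain p where p: "p \<in> pieces g x y" "e \<subseteq> verts p" using pieces_cover_edge by blast
    then have "e \<in> edges p - D p" using pieces_edges[OF p(1)] e by blast
    then obtain c where c: "c \<in> C p" "e \<in> edges c" "\<And>c'. c' \<in> C p \<Longrightarrow> e \<in> edges c' \<Longrightarrow> c' = c"
      using split.IH[OF p(1)] by blast
    show "\<exists>!c. c \<in> (\<Union>p\<in>pieces g x y. C p) \<and> e \<in> edges c"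
    proof (rule ex1I)
      show "c \<in> (\<Union>p\<in>pieces g x y. C p) \<and> e \<in> edges c" using c p by blast
      fix c' assume "c' \<in> (\<Union>p\<in>pieces g x y. C p) \<and> e \<in> edges c'"
      then obtain q where q: "q \<in> pieces g x y" "c' \<in> C q" "e \<in> edges c'" by blast
      then have "q = p"
        using pieces_pair[OF q(1) p(1) _ p(2)] part_component_edge_subset[OF q] e by blast
      then show "c' = c" using q c(3) by blast
    qed
  qed
qed auto

context splitting
begin

text \<open>Within each piece \<open>{x, y}\<close> is an edge but not a bond, so a single component
  \<open>l p\<close> of that piece contains it. The new bond therefore has one neighbour per
  piece.\<close>

lemma linked_xy:
  "\<exists>l. (\<forall>p\<in>pieces h x y. linked (C p) {x, y} = {l p}) \<and>
    linked (\<Union>p\<in>pieces h x y. C p) {x, y} = l ` pieces h x y \<and> inj_on l (pieces h x y)"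
proof -
  define l where "l p = (THE c. c \<in> C p \<and> {x, y} \<in> edges c)" for p
  have l: "linked (C p) {x, y} = {l p}" if p: "p \<in> pieces h x y" for p
  proof -
    have "{x, y} \<in> edges p - D p" using pieces_ends[OF p] part_bond_neq[OF p] by blast
    then have ex1: "\<exists>!c. c \<in> C p \<and> {x, y} \<in> edges c"
      using edge_unique_component[OF parts[OF p] pieces_biconnected[OF p]] by blast
    show ?thesis using theI'[OF ex1] ex1 unfolding linked_def l_def[symmetric] by blast
  qed
  then have in_part: "l p \<in> C p" if "p \<in> pieces h x y" for p using that unfolding linked_def by blast
  show ?thesis
  proof (intro exI[of _ l] conjI ballI l)
    have "linked (\<Union>p\<in>pieces h x y. C p) {x, y} = (\<Union>p\<in>pieces h x y. linked (C p) {x, y})"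
      unfolding linked_def by blast
    also have "\<dots> = l ` pieces h x y" using l by auto
    finally show "linked (\<Union>p\<in>pieces h x y. C p) {x, y} = l ` pieces h x y" .
    show "inj_on l (pieces h x y)"
    proof (rule inj_onI)
      fix p q assume pq: "p \<in> pieces h x y" "q \<in> pieces h x y" "l p = l q"
      show "p = q"
        using part_component_in_one[OF pq(2) in_part[OF pq(2)] pq(1)]
          part_component_subset[OF pq(1) in_part[OF pq(1)]] pq(3) by simp
    qed
  qed
qed

end

text \<open>A splitting step joins the trees of the pieces by one new black vertex with one edge to
  each of them. In every tree the nodes exceed the incidences by one; joining adds one node and as
  many incidences as there are pieces, which restores this excess.\<close>

lemma tree_count:
  assumes "splits_into g C D" "biconnected g"
  shows "card C + card D = Suc (\<Sum>b\<in>D. card (linked C b))"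
  using assms
proof (induction rule: splits_induct)
  case (split g x y C D)
  interpret splitting g x y C D by (rule split.hyps)
  let ?P = "pieces g x y"
  have fin: "finite (C p)" "finite (D p)" if "p \<in> ?P" for p
    using finite_splits[OF parts[OF that] pieces_biconnected[OF that]] by auto
  have disjC: "C p \<inter> C q = {}" if "p \<in> ?P" "q \<in> ?P" "p \<noteq> q" for p q
    using part_component_in_one[OF that(1) _ that(2)] part_component_subset[OF that(2)] that(3) by blast
  have disjD: "D p \<inter> D q = {}" if "p \<in> ?P" "q \<in> ?P" "p \<noteq> q" for p q
    using part_bond_in_one[OF that(1) _ that(2)] part_bond_subset[OF that(2)] that(3) by blast
  have finD: "finite (\<Union>p\<in>?P. D p)" using fin finite_pieces by blast
  have new: "{x, y} \<notin> (\<Union>p\<in>?P. D p)" using part_bond_neq by blast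
  obtain l where l: "linked (\<Union>p\<in>?P. C p) {x, y} = l ` ?P" "inj_on l ?P" using linked_xy by blast
  have "card (\<Union>p\<in>?P. C p) + card (insert {x, y} (\<Union>p\<in>?P. D p)) =
      Suc ((\<Sum>p\<in>?P. card (C p)) + (\<Sum>p\<in>?P. card (D p)))"
    using finD new fin finite_pieces disjC disjD by (simp add: card_UN_disjoint)
  also have "\<dots> = Suc (\<Sum>p\<in>?P. Suc (\<Sum>b\<in>D p. card (linked (C p) b)))"
    using split.IH by (simp add: sum.distrib[symmetric])
  also have "\<dots> = Suc (card ?P + (\<Sum>p\<in>?P. \<Sum>b\<in>D p. card (linked (\<Union>p\<in>?P. C p) b)))"
    by (simp add: sum_Suc linked_part)
  also have "(\<Sum>p\<in>?P. \<Sum>b\<in>D p. card (linked (\<Union>p\<in>?P. C p) b)) =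
      (\<Sum>b\<in>(\<Union>p\<in>?P. D p). card (linked (\<Union>p\<in>?P. C p) b))"
    using fin finite_pieces disjD by (intro sum.UNION_disjoint[symmetric]) auto
  also have "card ?P = card (linked (\<Union>p\<in>?P. C p) {x, y})" using l by (simp add: card_image)
  finally show ?case using finD new by simp
qed simp

text \<open>Together with the next two lemmas this characterises the vertex sets of components
  through the bonds alone: they are the maximal sets of more than two vertices that no bond
  separates.\<close>

lemma component_unseparated:
  assumes "splits_into g C D" "biconnected g"
  shows "\<forall>c\<in>C. \<forall>b\<in>D. \<forall>s\<in>verts c - b. \<forall>t\<in>verts c - b. reach (edges g) b s t"
  using assms
proof (induction rule: splits_induct)
  case (split g x y C D)
  interpret splitting g x y C D by (rule split.hyps)
  show ?case
  proof (intro ballI)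
    fix c b s t
    assume c: "c \<in> (\<Union>p\<in>pieces g x y. C p)" and b: "b \<in> insert {x, y} (\<Union>p\<in>pieces g x y. D p)"
      and st: "s \<in> verts c - b" "t \<in> verts c - b"
    from c obtain p where p: "p \<in> pieces g x y" "c \<in> C p" by blast
    have stp: "s \<in> verts p - b" "t \<in> verts p - b" using part_component_subset[OF p] st by blast+
    consider "b = {x, y}" | "b \<in> D p" | q where "q \<in> pieces g x y" "b \<in> D q" "q \<noteq> p"
      using b by blast
    then show "reach E b s t"
    proof cases
      case 1
      obtain K where K: "K \<in> cl" "p = piece K" using p(1) by (elim pieceE)
      then show ?thesis using stp 1 class_reach[OF K(1), of s t] by auto
    next
      case 2
      then have "reach (edges p) b s t" using split.IH[OF p(1)] p(2) st by blast
      then show ?thesis using pieces_reach_iff[OF p(1) part_bond_subset[OF p(1) 2]] stp by blast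
    next
      case (3 q)
      have bq: "b \<subseteq> verts q" "b \<noteq> {x, y}" by (rule part_bond_subset[OF 3(1,2)] part_bond_neq[OF 3(1,2)])+
      \<comment> \<open>A bond of another piece has at most one vertex in \<open>p\<close>, so
        2-connectedness of \<open>p\<close> suffices after deleting \<open>z\<close>. The reinserted
        edge of \<open>p\<close> is lifted to \<open>g\<close> by way of \<open>q\<close>, where it
        is an edge avoiding \<open>b\<close>.\<close>
      obtain z z' where z: "b = {z, z'}" "z' \<notin> verts p"
      proof -
        obtain z z' where "b = {z, z'}" using bond_separating[OF parts[OF 3(1)] pieces_biconnected[OF 3(1)] 3(2)] by blast
        moreover have "\<not> b \<subseteq> verts p" using part_bond_in_one[OF 3(1,2) p(1)] 3(3) by blast
        ultimately show thesis using that[of z z'] that[of z' z] by auto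
      qed
      have "reach (edges p) {z} s t"
        using stp z by (intro biconnected_reach[OF pieces_biconnected[OF p(1)]]) auto
      then show ?thesis
      proof (rule reach_subst)
        fix u v assume e: "{u, v} \<in> edges p" "u \<notin> {z}" "v \<notin> {z}"
        then have "u \<notin> b" "v \<notin> b" using simple_edge_subset[OF pieces_biconnected[OF p(1)] e(1)] z by auto
        moreover have "reach E b x y" if "x \<notin> b" "y \<notin> b"
          using pieces_reach_iff[OF 3(1) bq(1), of x y] pieces_ends[OF 3(1)] reach_edge[of x y "edges q" b] that by blast
        ultimately show "reach E b u v"
          using e(1) reach_sym[of E b x y] reach_edge[of u v E b] unfolding pieces_edges[OF p(1)]
          by (auto simp: doubleton_eq_iff)
      qed
    qed
  qed
qed simp

text \<open>The bound on \<open>card X\<close> excludes \<open>X \<subseteq> {x, y}\<close>, a set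
  that would fit into several pieces. Otherwise \<open>X\<close> meets some class and, not being
  separated by \<open>{x, y}\<close>, lies in the piece of that class.\<close>

lemma unseparated_in_component:
  assumes "splits_into g C D" "biconnected g"
  shows "\<forall>X. X \<subseteq> verts g \<longrightarrow> 2 < card X \<longrightarrow>
      (\<forall>b\<in>D. \<forall>s\<in>X - b. \<forall>t\<in>X - b. reach (edges g) b s t) \<longrightarrow> (\<exists>c\<in>C. X \<subseteq> verts c)"
  using assms
proof (induction rule: splits_induct)
  case (split g x y C D)
  interpret splitting g x y C D by (rule split.hyps)
  show ?case
  proof (intro allI impI)
    fix X assume X: "X \<subseteq> verts g" "2 < card X"
      "\<forall>b\<in>insert {x, y} (\<Union>p\<in>pieces g x y. D p). \<forall>s\<in>X - b. \<forall>t\<in>X - b. reach E b s t"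
    have "\<not> X \<subseteq> {x, y}"
      using X(2) card_mono[of "{x, y}" X] xy(1) by auto
    then obtain s where s: "s \<in> X" "s \<notin> {x, y}" by blast
    then obtain K where K: "K \<in> cl" "s \<in> K" using class_cover X(1) by blast
    have p: "piece K \<in> pieces g x y" using K by (simp add: pieces_eq)
    have "t \<in> K" if "t \<in> X - {x, y}" for t
      using class_reachD[OF K, of t] X(1,3) s that by blast
    then have Xp: "X \<subseteq> verts (piece K)" by auto
    have "reach (edges (piece K)) b s t" if "b \<in> D (piece K)" "s \<in> X - b" "t \<in> X - b" for b s t
    proof -
      have "reach E b s t" using X(3) that p by blast
      then show ?thesis using pieces_reach[OF p] Xp that by blast
    qed
    then have "\<exists>c\<in>C (piece K). X \<subseteq> verts c"
      using split.IH[OF p, rule_format, OF Xp X(2)] by blast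
    then show "\<exists>c\<in>(\<Union>p\<in>pieces g x y. C p). X \<subseteq> verts c" using p by blast
  qed
qed simp

lemma component_antichain:
  assumes "splits_into g C D" "biconnected g"
  shows "\<forall>c\<in>C. \<forall>c'\<in>C. verts c \<subseteq> verts c' \<longrightarrow> c = c'"
  using assms
proof (induction rule: splits_induct)
  case (split g x y C D)
  interpret splitting g x y C D by (rule split.hyps)
  show ?case
  proof (intro ballI impI)
    fix c c' assume "c \<in> (\<Union>p\<in>pieces g x y. C p)" "c' \<in> (\<Union>p\<in>pieces g x y. C p)"
      and sub: "verts c \<subseteq> verts c'"
    then obtain p q where p: "p \<in> pieces g x y" "c \<in> C p" and q: "q \<in> pieces g x y" "c' \<in> C q" by blast
    have "q = p"
      using part_component_in_one[OF p q(1)] part_component_subset[OF q] sub by blast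
    then show "c = c'" using split.IH[OF p(1)] p q sub by blast
  qed
qed simp

text \<open>A component of one splitting lies in a component of the other, which again lies in one
  of the first. The antichain property makes the two ends of this chain equal, hence all three
  vertex sets.\<close>

lemma components_determined:
  assumes "splits_into g C D" "splits_into g C' D" "biconnected g"
  shows "C = C'"
proof -
  have "C \<subseteq> C'" if s: "splits_into g C D" "splits_into g C' D" for C C'
  proof
    fix c assume c: "c \<in> C"
    have "\<exists>c'\<in>C'. verts c \<subseteq> verts c'"
      by (rule unseparated_in_component[OF s(2) assms(3), rule_format])
        (use component_unseparated[OF s(1) assms(3)] c component_facts[OF s(1) assms(3) c]
          biconnectedD(3)[of c] in auto)
    then obtain c' where c': "c' \<in> C'" "verts c \<subseteq> verts c'" by blast
    have "\<exists>c''\<in>C. verts c' \<subseteq> verts c''"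
      by (rule unseparated_in_component[OF s(1) assms(3), rule_format])
        (use component_unseparated[OF s(2) assms(3)] c' component_facts[OF s(2) assms(3) c'(1)]
          biconnectedD(3)[of c'] in auto)
    then obtain c'' where c'': "c'' \<in> C" "verts c' \<subseteq> verts c''" by blast
    have "c = c''" using component_antichain[OF s(1) assms(3)] c c'' c'(2) by blast
    then have "verts c = verts c'" using c' c'' by blast
    moreover from this have "edges c = edges c'"
      using component_edges[OF s(1) assms(3)] component_edges[OF s(2) assms(3)] c c'(1) by simp
    ultimately have "c = c'" by (rule ugraph.expand[OF conjI])
    then show "c \<in> C'" using c'(1) by simp
  qed
  then show ?thesis using assms by blast
qed

text \<open>This makes the sides of different components at one bond disjoint when they are weighed.
  For the new bond two linked components belong to different pieces, hence to different
  classes.\<close>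

lemma linked_distinct_sides:
  assumes "splits_into g C D" "biconnected g"
  shows "\<forall>b\<in>D. \<forall>c\<in>linked C b. \<forall>c'\<in>linked C b. \<forall>s\<in>verts c - b. \<forall>t\<in>verts c' - b.
      reach (edges g) b s t \<longrightarrow> c = c'"
  using assms
proof (induction rule: splits_induct)
  case (split g x y C D)
  interpret splitting g x y C D by (rule split.hyps)
  let ?C = "\<Union>p\<in>pieces g x y. C p"
  show ?case
  proof (intro ballI impI)
    fix b c c' s t
    assume b: "b \<in> insert {x, y} (\<Union>p\<in>pieces g x y. D p)" and c: "c \<in> linked ?C b" "c' \<in> linked ?C b"
      and st: "s \<in> verts c - b" "t \<in> verts c' - b" and r: "reach E b s t"
    from b consider "b = {x, y}" | p where "p \<in> pieces g x y" "b \<in> D p" by blast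
    then show "c = c'"
    proof cases
      case 1
      from c obtain p q where p: "p \<in> pieces g x y" "c \<in> C p" "{x, y} \<in> edges c"
        and q: "q \<in> pieces g x y" "c' \<in> C q" "{x, y} \<in> edges c'" unfolding linked_def 1 by blast
      obtain K where K: "K \<in> cl" "p = piece K" using p(1) by (elim pieceE)
      obtain K' where K': "K' \<in> cl" "q = piece K'" using q(1) by (elim pieceE)
      have "s \<in> K" "t \<in> K'" using st part_component_subset[OF p(1,2)] part_component_subset[OF q(1,2)] K K' 1 by auto
      moreover have "t \<in> K"
        using class_reachD[OF K(1) \<open>s \<in> K\<close>, of t] class_subset[OF K'(1)] \<open>t \<in> K'\<close> r 1 by blast
      ultimately have "p = q" using class_disjoint[OF K(1) K'(1)] K K' by blast
      obtain l where "linked (C p) {x, y} = {l p}" using linked_xy p(1) by blast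
      then have "{c \<in> C p. {x, y} \<in> edges c} = {l p}" by (simp add: linked_def)
      moreover have "c \<in> {c \<in> C p. {x, y} \<in> edges c}" "c' \<in> {c \<in> C p. {x, y} \<in> edges c}"
        using p q \<open>p = q\<close> by auto
      ultimately show ?thesis by simp
    next
      case (2 p)
      have c: "c \<in> linked (C p) b" "c' \<in> linked (C p) b" using c linked_part[OF 2] by auto
      then have "s \<in> verts p" "t \<in> verts p" using st part_component_subset[OF 2(1)] unfolding linked_def by auto
      then have "reach (edges p) b s t" using pieces_reach[OF 2(1) r] by blast
      then show ?thesis using split.IH[OF 2(1)] 2(2) c st by blast
    qed
  qed
qed simp

subsection \<open>Existence and uniqueness of the decomposition\<close>

lemma three_connected_reach:
  assumes "k_connected 3 g" "a \<in> verts g" "b \<in> verts g" "s \<in> verts g - {a, b}" "t \<in> verts g - {a, b}"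
  shows "reach (edges g) {a, b} s t"
proof -
  have "card {a, b} < 3" by (simp add: card_insert_if)
  then have "connected_graph (delete_verts g {a, b})"
    using assms(1-3) by (simp add: k_connected_def)
  then show ?thesis using assms(4,5) by (simp add: connected_delete_iff)
qed

text \<open>No splitting step can destroy such a pair. It lies in one piece, since otherwise
  \<open>{x, y}\<close> would cross it, and there it remains separating and uncrossed until it is
  used. Final pieces contain none: 3-connected graphs have no separating pair, and those of polygons
  are crossed.\<close>

lemma uncrossed_pair_bond:
  assumes "splits_into g C D" "biconnected g"
  shows "\<forall>a b. separating_pair g a b \<longrightarrow> \<not> crossed (edges g) a b \<longrightarrow> {a, b} \<in> D"
  using assms
proof (induction rule: splits_induct)
  case (stop g)
  show ?case
  proof (intro allI impI)
    fix a b assume ab: "separating_pair g a b" "\<not> crossed (edges g) a b"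
    show "{a, b} \<in> {}"
    proof (cases "polygon g")
      case True
      then show ?thesis using polygon_separating_pair_crossed[OF _ ab(1)] ab(2) by simp
    next
      case False
      then have "k_connected 3 g" using stop by blast
      then show ?thesis using three_connected_reach[of g a b] ab(1) unfolding separating_pair_iff by blast
    qed
  qed
next
  case (split g x y C D)
  interpret splitting g x y C D by (rule split.hyps)
  show ?case
  proof (intro allI impI)
    fix a b assume ab: "separating_pair g a b" and nc: "\<not> crossed E a b"
    have ab_verts: "a \<noteq> b" "a \<in> verts g" "b \<in> verts g" using ab by (auto simp: separating_pair_def)
    show "{a, b} \<in> insert {x, y} (\<Union>p\<in>pieces g x y. D p)"
    proof (cases "{a, b} = {x, y}")
      case False
      have other: "t \<in> K \<union> {x, y}"
        if "K \<in> cl" "s \<in> K" "\<not> crossed E s t" "t \<in> verts g" for K s t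
      proof (rule ccontr)
        assume t: "t \<notin> K \<union> {x, y}"
        then have "\<not> reach E {x, y} s t" using class_reachD[OF that(1,2), of t] that(4) by blast
        then have "crossed E s t"
          using t class_subset[OF that(1)] that(2) by (intro crossedI[of x _ _ y]) auto
        then show False using that(3) by simp
      qed
      have "\<exists>K\<in>cl. a \<in> K \<union> {x, y} \<and> b \<in> K \<union> {x, y}"
      proof (cases "a \<in> {x, y}")
        case True
        then have "b \<notin> {x, y}" using False ab_verts(1) by auto
        then obtain K where "K \<in> cl" "b \<in> K" using class_cover[OF ab_verts(3)] by blast
        then show ?thesis using True by blast
      next
        case a: False
        then obtain K where K: "K \<in> cl" "a \<in> K" using class_cover[OF ab_verts(2)] by blast
        then show ?thesis using other[OF K nc ab_verts(3)] by blast
      qed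
      then obtain K where K: "K \<in> cl" "a \<in> K \<union> {x, y}" "b \<in> K \<union> {x, y}" by blast
      define p where "p = piece K"
      have p: "p \<in> pieces g x y" "a \<in> verts p" "b \<in> verts p" using K by (auto simp: p_def pieces_eq)
      have "\<not> crossed (edges p) a b"
        using nc pieces_reach[OF p(1) _ p(2,3)] unfolding crossed_def by meson
      moreover have "separating_pair p a b"
      proof (rule ccontr)
        assume "\<not> separating_pair p a b"
        then have conn: "reach (edges p) {a, b} s t" if "s \<in> verts p - {a, b}" "t \<in> verts p - {a, b}" for s t
          using that p ab_verts(1) unfolding separating_pair_iff by blast
        \<comment> \<open>If \<open>{a, b}\<close> did not separate \<open>p\<close>, the end
          \<open>w\<close> could be reached from everywhere in \<open>g\<close> without
          \<open>a\<close> and \<open>b\<close>: from \<open>p\<close> by assumption, and from any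
          other class because it contains neither of them.\<close>
        obtain w where w: "w \<in> {x, y}" "w \<notin> {a, b}" using False ab_verts(1) xy(1) by auto
        have "reach E {a, b} v w" if v: "v \<in> verts g - {a, b}" for v
        proof (cases "v \<in> verts p")
          case True
          have "w \<in> verts p" using w K by (auto simp: p_def)
          then have "reach (edges p) {a, b} v w" using conn True v w by blast
          then show ?thesis
            using pieces_reach_iff[OF p(1), of "{a, b}"] p True \<open>w \<in> verts p\<close> by simp
        next
          case vp: False
          then have "v \<notin> {x, y}" by (auto simp: p_def)
          then obtain K' where K': "K' \<in> cl" "v \<in> K'" using class_cover v by blast
          then have "K' \<noteq> K" using vp by (auto simp: p_def)
          then have "{a, b} \<inter> K' = {}"
            using class_disjoint[OF K(1) K'(1)] class_subset[OF K'(1)] K by blast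
          then show ?thesis using class_to_end[OF K' _ w] by blast
        qed
        then have "reach E {a, b} s t" if "s \<in> verts g - {a, b}" "t \<in> verts g - {a, b}" for s t
          using that reach_sym[of E "{a, b}" t w] reach_trans[of E "{a, b}" s w t] by blast
        then show False using ab unfolding separating_pair_iff by blast
      qed
      ultimately have "{a, b} \<in> D p" using split.IH[OF p(1)] by blast
      then show ?thesis using p(1) by blast
    qed simp
  qed
qed

text \<open>If \<open>u\<close> leaves the current piece during the splitting, an end of the splitting pair takes
  over its role.\<close>

lemma cut_edge_component_polygon:
  assumes "splits_into g C D" "biconnected g"
  shows "\<forall>s t u c. {s, t} \<in> edges g \<longrightarrow> u \<in> verts g - {s, t} \<longrightarrow>
      \<not> reach (edges g - {{s, t}}) {u} s t \<longrightarrow> c \<in> C \<longrightarrow> {s, t} \<in> edges c \<longrightarrow> polygon c"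
  using assms
proof (induction rule: splits_induct)
  case (stop g)
  show ?case
  proof (intro allI impI)
    fix s t u c
    assume st: "{s, t} \<in> edges g" and u: "u \<in> verts g - {s, t}"
      and nr: "\<not> reach (edges g - {{s, t}}) {u} s t" and c: "c \<in> {g}"
    have st': "s \<in> verts g" "t \<in> verts g" "s \<noteq> t"
      using simple_edge[OF biconnectedD(1)[OF stop(1)] st] by auto
    have "\<not> k_connected 3 g"
    proof
      assume k3: "k_connected 3 g"
      have "card {s, t, u} \<le> 3" by (simp add: card_insert_if)
      then have "\<not> verts g \<subseteq> {s, t, u}"
        using k3 card_mono[of "{s, t, u}" "verts g"] unfolding k_connected_def by force
      \<comment> \<open>A fourth vertex reaches \<open>t\<close> avoiding \<open>u\<close> and
        \<open>s\<close>, and reaches \<open>s\<close> avoiding \<open>u\<close> and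
        \<open>t\<close>. Neither walk uses the edge \<open>{s, t}\<close>, so together they join
        \<open>s\<close> to \<open>t\<close> without it.\<close>
      then obtain z where z: "z \<in> verts g" "z \<notin> {s, t, u}" by blast
      have "reach (edges g - {{s, t}}) {u} z t"
        by (rule reach_subst[OF three_connected_reach[OF k3, of u s z t]])
          (use z u st' in \<open>auto simp: reach_edge doubleton_eq_iff\<close>)
      moreover have "reach (edges g - {{s, t}}) {u} z s"
        by (rule reach_subst[OF three_connected_reach[OF k3, of u t z s]])
          (use z u st' in \<open>auto simp: reach_edge doubleton_eq_iff\<close>)
      ultimately show False using nr reach_sym[of _ _ z s] reach_trans[of _ _ s z t] by simp
    qed
    then show "polygon c" using stop c by blast
  qed
next
  case (split g x y C D)
  interpret splitting g x y C D by (rule split.hyps)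
  show ?case
  proof (intro allI impI)
    fix s t u c
    assume st: "{s, t} \<in> E" and u: "u \<in> verts g - {s, t}"
      and nr: "\<not> reach (E - {{s, t}}) {u} s t"
      and c: "c \<in> (\<Union>p\<in>pieces g x y. C p)" "{s, t} \<in> edges c"
    from c obtain p where p: "p \<in> pieces g x y" "c \<in> C p" by blast
    obtain K where K: "K \<in> cl" "p = piece K" using p(1) by (elim pieceE)
    have stp: "s \<in> verts p" "t \<in> verts p" using part_component_edge_subset[OF p c(2)] by auto
    then have st_edge: "{s, t} \<in> edges p" using st pieces_edges[OF p(1)] by auto
    have st': "s \<noteq> t" using simple_edge[OF biconnectedD(1)[OF bic] st] by auto
    \<comment> \<open>If the edge were the splitting pair, a class not containing \<open>u\<close>
      would join its ends without using the edge.\<close>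
    have ne: "{s, t} \<noteq> {x, y}"
    proof
      assume eq: "{s, t} = {x, y}"
      obtain K' where K': "K' \<in> cl" "u \<notin> K'"
      proof -
        obtain K' where K': "K' \<in> cl" "K' \<noteq> K" using class_other[OF K(1)] by blast
        then have "K \<inter> K' = {}" using class_disjoint[OF K(1)] by blast
        then show thesis using that K(1) K'(1) by blast
      qed
      have "reach (E - {{s, t}}) {u} x y"
      proof (rule class_across[OF K'(1)])
        show "{u} \<inter> (K' \<union> {x, y}) = {}" using K' u eq by auto
        fix e assume "e \<in> E" "e \<inter> K' \<noteq> {}"
        then show "e \<in> E - {{s, t}}" using class_subset[OF K'(1)] unfolding eq by blast
      qed
      then have "reach (E - {{s, t}}) {u} s t" using eq by (rule reach_pair)
      then show False using nr by simp
    qed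
    show "polygon c"
    proof (cases "u \<in> verts p")
      case True
      have "\<not> reach (edges p - {{s, t}}) {u} s t"
      proof
        assume "reach (edges p - {{s, t}}) {u} s t"
        then have "reach (E - {{s, t}}) {u} s t"
        proof (rule reach_subst)
          fix a b assume e: "{a, b} \<in> edges p - {{s, t}}" "a \<notin> {u}" "b \<notin> {u}"
          show "reach (E - {{s, t}}) {u} a b"
          proof (cases "{a, b} = {x, y}")
            case eq: True
            have "u \<notin> {a, b}" using e(2,3) by auto
            then have "{u} \<subseteq> K" using True K unfolding eq by simp
            then have "reach (E - {{s, t}}) {u} x y"
              by (rule piece_across[OF K(1)]) (use stp K in auto)
            then show ?thesis using eq by (rule reach_pair)
          next
            case False
            then have "{a, b} \<in> E - {{s, t}}" using e(1) pieces_edgeD[OF p(1), of "{a, b}"] by simp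
            then show ?thesis using e(2,3) by (rule reach_edge)
          qed
        qed
        then show False using nr by simp
      qed
      then show ?thesis using split.IH[OF p(1), rule_format, OF st_edge _ _ p(2) c(2), of u] True u by blast
    next
      case False
      obtain w where w: "w \<in> {x, y}" "w \<notin> {s, t}" using ne st' xy(1) by auto
      have "\<not> reach (edges p - {{s, t}}) {w} s t"
      proof
        assume "reach (edges p - {{s, t}}) {w} s t"
        then have "reach (E - {{s, t}}) {u} s t"
        proof (rule reach_subst)
          fix a b assume e: "{a, b} \<in> edges p - {{s, t}}" "a \<notin> {w}" "b \<notin> {w}"
          then have "w \<notin> {a, b}" by auto
          then have "{a, b} \<noteq> {x, y}" using w(1) by metis
          then have *: "{a, b} \<in> E - {{s, t}}" "{a, b} \<subseteq> verts p"
            using e(1) pieces_edgeD[OF p(1), of "{a, b}"] by simp_all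
          then show "reach (E - {{s, t}}) {u} a b" using False by (intro reach_edge) auto
        qed
        then show False using nr by simp
      qed
      moreover have "w \<in> verts p - {s, t}" using w pieces_ends[OF p(1)] by blast
      ultimately show ?thesis using split.IH[OF p(1), rule_format, OF st_edge _ _ p(2) c(2), of w] by blast
    qed
  qed
qed

text \<open>A crossing pair must meet every class, and each class needs a vertex of its own. So
  there are exactly two classes with one crossing vertex each. Without that vertex, the reinserted
  edge is the only link between \<open>x\<close> and \<open>y\<close> in its piece, and the
  component containing this edge is a polygon.\<close>

lemma crossed_bond_two_polygons:
  assumes "splits_into g C D" "biconnected g"
  shows "\<forall>s t. {s, t} \<in> D \<longrightarrow> crossed (edges g) s t \<longrightarrow>
      {s, t} \<notin> edges g \<and> card (linked C {s, t}) = 2 \<and> (\<forall>c\<in>linked C {s, t}. polygon c)"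
  using assms
proof (induction rule: splits_induct)
  case (split g x y C D)
  interpret splitting g x y C D by (rule split.hyps)
  let ?C = "\<Union>p\<in>pieces g x y. C p"
  have new: "{x, y} \<notin> E \<and> card (linked ?C {x, y}) = 2 \<and> (\<forall>c\<in>linked ?C {x, y}. polygon c)"
    if cr: "crossed E x y"
  proof -
    obtain u v where uv: "{u, v} \<inter> {x, y} = {}" "\<not> reach E {u, v} x y"
      using cr unfolding crossed_def by blast
    have hit: "u \<in> K \<or> v \<in> K" if "K \<in> cl" for K
      using class_across[OF that, of "{u, v}" E] uv by blast
    have once: "\<not> (u \<in> K \<and> v \<in> K)" if K: "K \<in> cl" for K
    proof -
      obtain K' where "K' \<in> cl" "K' \<noteq> K" using class_other[OF K] by blast
      then show ?thesis using hit class_disjoint[OF K, of K'] by blast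
    qed
    have nxy: "{x, y} \<notin> E" using uv reach_edge[of x y E "{u, v}"] by auto
    obtain a where "a \<in> verts g" "a \<notin> {x, y}" using sep unfolding separating_pair_iff by blast
    then obtain K where K: "K \<in> cl" using class_cover by blast
    obtain K' where K': "K' \<in> cl" "K' \<noteq> K" using class_other[OF K] by blast
    have "L = K \<or> L = K'" if "L \<in> cl" for L
      using hit[OF that] hit[OF K] hit[OF K'(1)] class_disjoint[OF that K] class_disjoint[OF that K'(1)]
        class_disjoint[OF K K'(1)] K'(2) by blast
    then have "cl = {K, K'}" using K K' by blast
    moreover have "piece K \<noteq> piece K'" using piece_inj[OF K K'(1)] K'(2) by blast
    ultimately have "card (pieces g x y) = 2" by (simp add: pieces_eq)
    moreover obtain l where "linked ?C {x, y} = l ` pieces g x y" "inj_on l (pieces g x y)"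
      using linked_xy by blast
    ultimately have card: "card (linked ?C {x, y}) = 2" by (simp add: card_image)
    have "polygon c" if c: "c \<in> linked ?C {x, y}" for c
    proof -
      from c obtain p where p: "p \<in> pieces g x y" "c \<in> C p" "{x, y} \<in> edges c"
        unfolding linked_def by blast
      obtain K where K: "K \<in> cl" "p = piece K" using p(1) by (elim pieceE)
      obtain w w' where w: "{w, w'} = {u, v}" "w \<in> K" "w' \<notin> K"
        using hit[OF K(1)] once[OF K(1)] by blast
      have "\<not> reach (edges p - {{x, y}}) {w} x y"
      proof
        assume "reach (edges p - {{x, y}}) {w} x y"
        then have "reach E {u, v} x y"
        proof (rule reach_subst)
          fix a b assume e: "{a, b} \<in> edges p - {{x, y}}" "a \<notin> {w}" "b \<notin> {w}"
          then have *: "{a, b} \<in> E" "{a, b} \<subseteq> K \<union> {x, y}"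
            using pieces_edgeD[OF p(1), of "{a, b}"] K by simp_all
          have "w' \<notin> {x, y}" using w(1) uv(1) by blast
          then show "reach E {u, v} a b"
            using * e(2,3) w(3) unfolding w(1)[symmetric] by (intro reach_edge) auto
        qed
        then show False using uv(2) by simp
      qed
      moreover have "w \<in> verts p - {x, y}" using w K class_subset[OF K(1)] by auto
      ultimately show ?thesis
        using cut_edge_component_polygon[OF parts[OF p(1)] pieces_biconnected[OF p(1)],
            rule_format, of x y w c] pieces_ends[OF p(1)] p by blast
    qed
    then show ?thesis using nxy card by blast
  qed
  show ?case
  proof (intro allI impI)
    fix s t assume st: "{s, t} \<in> insert {x, y} (\<Union>p\<in>pieces g x y. D p)" and cr: "crossed E s t"
    show "{s, t} \<notin> E \<and> card (linked ?C {s, t}) = 2 \<and> (\<forall>c\<in>linked ?C {s, t}. polygon c)"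
    proof (cases "{s, t} = {x, y}")
      case True
      then have "crossed E x y" using cr crossed_commute[of E y x] unfolding doubleton_eq_iff by auto
      then show ?thesis using new unfolding True by blast
    next
      case False
      then obtain p where p: "p \<in> pieces g x y" "{s, t} \<in> D p" using st by blast
      have stp: "s \<in> verts p" "t \<in> verts p" "s \<noteq> t"
        using part_bond_subset[OF p] bond_subset(2)[OF parts[OF p(1)] pieces_biconnected[OF p(1)] p(2)] by auto
      obtain w where w: "w \<in> {x, y}" "w \<notin> {s, t}" using False stp(3) xy(1) by auto
      obtain u v where uv: "{u, v} \<inter> {s, t} = {}" "\<not> reach E {u, v} s t"
        using cr unfolding crossed_def by blast
      \<comment> \<open>A crossing vertex outside the piece may be exchanged for \<open>w\<close>. A
        walk of \<open>p\<close> avoiding \<open>w\<close> cannot use the reinserted edge, so it is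
        a walk of \<open>g\<close>, and it avoids \<open>u\<close> because \<open>u\<close> is not
        in \<open>p\<close>.\<close>
      have replace: "crossed (edges p) s t"
        if u: "u \<notin> verts p" and uv: "{u, v} \<inter> {s, t} = {}" "\<not> reach E {u, v} s t" for u v
      proof -
        have "\<not> reach (edges p) {w, v} s t"
        proof
          assume "reach (edges p) {w, v} s t"
          then have "reach E {u, v} s t"
          proof (rule reach_subst)
            fix a b assume e: "{a, b} \<in> edges p" "a \<notin> {w, v}" "b \<notin> {w, v}"
            then have "w \<notin> {a, b}" by auto
            then have "{a, b} \<noteq> {x, y}" using w(1) by metis
            then have "{a, b} \<in> E" "{a, b} \<subseteq> verts p"
              using e(1) pieces_edgeD[OF p(1), of "{a, b}"] by simp_all
            then show "reach E {u, v} a b" using e(2,3) u by (intro reach_edge) auto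
          qed
          then show False using uv by simp
        qed
        then show ?thesis using w uv(1) by (intro crossedI[of w _ _ v]) auto
      qed
      have "crossed (edges p) s t"
      proof (cases "u \<in> verts p \<and> v \<in> verts p")
        case True
        then have "\<not> reach (edges p) {u, v} s t" using pieces_reach_iff[OF p(1), of "{u, v}" s t] stp uv by simp
        then show ?thesis using uv(1) by (intro crossedI[of u _ _ v]) auto
      next
        case False
        moreover have "{v, u} = {u, v}" by blast
        ultimately show ?thesis using replace[of u v] replace[of v u] uv by metis
      qed
      then have "{s, t} \<notin> edges p \<and> card (linked (C p) {s, t}) = 2 \<and> (\<forall>c\<in>linked (C p) {s, t}. polygon c)"
        using split.IH[OF p(1), rule_format, OF p(2)] by simp
      moreover have "{s, t} \<notin> E" using calculation stp pieces_edges[OF p(1)] by simp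
      ultimately show ?thesis using linked_part[OF p] by simp
    qed
  qed
qed simp

text \<open>A walk from \<open>s\<close> to \<open>t\<close> that avoids \<open>u\<close> and the
  edge \<open>{s, t}\<close> would project to the piece at every stage. The lemma is applied to
  polygons, where each edge admits such a vertex \<open>u\<close>.\<close>

lemma polygon_component_edge_cut:
  assumes "splits_into g C D" "biconnected g"
  shows "\<forall>s t u c. {s, t} \<in> edges g - D \<longrightarrow> c \<in> C \<longrightarrow> {s, t} \<in> edges c \<longrightarrow>
      \<not> reach (edges c - {{s, t}}) {u} s t \<longrightarrow> \<not> reach (edges g - {{s, t}}) {u} s t"
  using assms
proof (induction rule: splits_induct)
  case (split g x y C D)
  interpret splitting g x y C D by (rule split.hyps)
  show ?case
  proof (intro allI impI notI)
    fix s t u c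
    assume st: "{s, t} \<in> E - insert {x, y} (\<Union>p\<in>pieces g x y. D p)"
      and c: "c \<in> (\<Union>p\<in>pieces g x y. C p)" "{s, t} \<in> edges c"
      and nr: "\<not> reach (edges c - {{s, t}}) {u} s t" and r: "reach (E - {{s, t}}) {u} s t"
    from c obtain p where p: "p \<in> pieces g x y" "c \<in> C p" by blast
    obtain K where K: "K \<in> cl" "p = piece K" using p(1) by (elim pieceE)
    have stp: "s \<in> verts p" "t \<in> verts p" using part_component_edge_subset[OF p c(2)] by auto
    then have "{s, t} \<in> edges p - D p" using st pieces_edges[OF p(1)] p(1) by auto
    then have "\<not> reach (edges p - {{s, t}}) {u} s t"
      by (rule split.IH[OF p(1), rule_format, OF _ p(2) c(2) nr])
    moreover have "reach (insert {x, y} {e \<in> E - {{s, t}}. e \<subseteq> K \<union> {x, y}}) {u} s t"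
      using stp K r by (intro piece_project) auto
    then have "reach (edges p - {{s, t}}) {u} s t"
      by (rule reach_mono) (use st pieces_edges[OF p(1)] K in auto)
    ultimately show False by blast
  qed
qed simp

definition maximal_polygons :: "'v ugraph \<Rightarrow> 'v ugraph set \<Rightarrow> 'v set set \<Rightarrow> bool" where
  "maximal_polygons g C D \<longleftrightarrow>
     \<not> (\<exists>b\<in>D. b \<notin> edges g \<and> card (linked C b) = 2 \<and> (\<forall>c\<in>linked C b. polygon c))"

text \<open>Splitting always along an uncrossed pair ends because pieces get smaller, and it creates
  no removable pair: if \<open>{x, y}\<close> merely glued two polygons, a suitable vertex from each
  of them would together cross it.\<close>

lemma decomposition_exists:
  assumes "biconnected g"
  shows "\<exists>C D. splits_into g C D \<and> maximal_polygons g C D"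
  using assms
proof (induction "card (verts g)" arbitrary: g rule: less_induct)
  case less
  from less.prems show ?case
  proof (cases rule: splitting_cases)
    case 1
    then have "splits_into g {g} {} \<and> maximal_polygons g {g} {}"
      by (auto simp: maximal_polygons_def intro: splits_into.stop)
    then show ?thesis by blast
  next
    case (2 x y)
    interpret cut g x y by (rule cut.intro[OF less.prems 2(1)])
    have "\<forall>p\<in>pieces g x y. \<exists>C D. splits_into p C D \<and> maximal_polygons p C D"
      using less.hyps piece_card_less pieces_biconnected by (metis pieceE)
    then obtain C D where CD: "\<And>p. p \<in> pieces g x y \<Longrightarrow> splits_into p (C p) (D p)"
      "\<And>p. p \<in> pieces g x y \<Longrightarrow> maximal_polygons p (C p) (D p)" by metis
    interpret splitting g x y C D by unfold_locales (rule CD(1))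
    let ?C = "\<Union>p\<in>pieces g x y. C p" and ?D = "insert {x, y} (\<Union>p\<in>pieces g x y. D p)"
    have False if b: "b \<in> ?D" "b \<notin> E" "card (linked ?C b) = 2" "\<forall>c\<in>linked ?C b. polygon c" for b
    proof -
      from b(1) consider "b = {x, y}" | p where "p \<in> pieces g x y" "b \<in> D p" by blast
      then show False
      proof cases
        case (2 p)
        have "b \<notin> edges p" using pieces_edges[OF 2(1)] b(2) part_bond_neq[OF 2] by auto
        then show False using CD(2)[OF 2(1)] b(3,4) 2(2) unfolding maximal_polygons_def linked_part[OF 2] by blast
      next
        case 1
        obtain l where l: "\<forall>p\<in>pieces g x y. linked (C p) {x, y} = {l p}"
          "linked ?C {x, y} = l ` pieces g x y" "inj_on l (pieces g x y)" using linked_xy by blast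
        have "card (pieces g x y) = 2" using b(3) l unfolding 1 by (metis card_image)
        then obtain p q where pq: "pieces g x y = {p, q}" "p \<noteq> q" by (auto simp: card_2_iff)
        have "\<exists>K u. p = piece K \<and> K \<in> cl \<and> u \<in> K \<and> \<not> reach (edges p - {{x, y}}) {u} x y"
          if p: "p \<in> pieces g x y" for p
        proof -
          obtain K where K: "K \<in> cl" "p = piece K" using p by (elim pieceE)
          have lp: "l p \<in> C p" "{x, y} \<in> edges (l p)" "polygon (l p)"
            using l(1) p b(4) 1 unfolding linked_def by blast+
          have "x \<in> verts (l p)"
            using simple_edge_subset[OF part_component_biconnected[OF p lp(1)] lp(2)] by blast
          then obtain u where u: "u \<in> verts (l p) - {x, y}" "\<not> reach (edges (l p) - {{x, y}}) {u} x y"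
            using polygon_edge_cut[OF lp(3,2) xy(1)] by blast
          have "{x, y} \<in> edges p - D p" using pieces_ends[OF p] part_bond_neq[OF p] by blast
          then have "\<not> reach (edges p - {{x, y}}) {u} x y"
            by (rule polygon_component_edge_cut[OF parts[OF p] pieces_biconnected[OF p],
                rule_format, OF _ lp(1,2) u(2)])
          moreover have "u \<in> K" using u(1) part_component_subset[OF p lp(1)] K by auto
          ultimately show ?thesis using K by blast
        qed
        then obtain K u K' v where K: "p = piece K" "K \<in> cl" "u \<in> K" "\<not> reach (edges p - {{x, y}}) {u} x y"
          and K': "q = piece K'" "K' \<in> cl" "v \<in> K'" "\<not> reach (edges q - {{x, y}}) {v} x y"
          using pq by (metis insertCI)
        have cl: "L = K \<or> L = K'" if "L \<in> cl" for L
          using pq K K' that piece_inj[of L K] piece_inj[of L K'] unfolding pieces_eq by blast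
        \<comment> \<open>This collects what \<open>x\<close> reaches in either piece without the
          reinserted edge, avoiding \<open>u\<close> in the one and \<open>v\<close> in the other.
          It is closed under steps of \<open>g\<close> that avoid both, and it misses
          \<open>y\<close>.\<close>
        define A where "A = {x} \<union> {w \<in> K. reach (edges p - {{x, y}}) {u} x w} \<union>
            {w \<in> K'. reach (edges q - {{x, y}}) {v} x w}"
        have step: "w \<in> {x} \<union> {w \<in> K. reach (edges (piece K) - {{x, y}}) {u} x w}"
          if K: "K \<in> cl" "\<not> reach (edges (piece K) - {{x, y}}) {u} x y"
            and e: "{a, w} \<in> E" "a \<noteq> u" "w \<noteq> u" "a \<in> K \<or> w \<in> K"
              "reach (edges (piece K) - {{x, y}}) {u} x a" for K u a w
        proof -
          have eK: "{a, w} \<subseteq> K \<union> {x, y}" using class_edge[OF K(1) e(1)] e(4) by blast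
          then have "{a, w} \<in> edges (piece K) - {{x, y}}"
            using e(1,4) class_subset[OF K(1)] by (auto simp: edges_piece doubleton_eq_iff)
          then have "reach (edges (piece K) - {{x, y}}) {u} a w" using e by (intro reach_edge) auto
          with e(5) have "reach (edges (piece K) - {{x, y}}) {u} x w" by (rule reach_trans)
          then show ?thesis using eK K(2) by auto
        qed
        have "\<not> reach E {u, v} x y"
        proof
          assume "reach E {u, v} x y"
          then have "y \<in> A"
          proof (rule reach_closed)
            fix a w assume a: "a \<in> A" and e: "{a, w} \<in> E" "a \<notin> {u, v}" "w \<notin> {u, v}"
            show "w \<in> A"
            proof (cases "w = x")
              case False
              consider "a \<in> K" | "a \<in> K'" | "a = x" using a by (auto simp: A_def)
              then have "(a \<in> K \<or> w \<in> K) \<and> reach (edges p - {{x, y}}) {u} x a \<or>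
                  (a \<in> K' \<or> w \<in> K') \<and> reach (edges q - {{x, y}}) {v} x a"
              proof cases
                case 1
                then show ?thesis using a class_disjoint[OF K(2) K'(2)] class_subset[OF K(2)] pq(2) K(1) K'(1)
                  unfolding A_def by blast
              next
                case 2
                then show ?thesis using a class_disjoint[OF K(2) K'(2)] class_subset[OF K'(2)] pq(2) K(1) K'(1)
                  unfolding A_def by blast
              next
                case 3
                \<comment> \<open>Here it matters that the pair is not an edge of \<open>g\<close>:
                  no step leads from \<open>x\<close> directly to \<open>y\<close>.\<close>
                have "w \<noteq> y" using e(1) 3 b(2) \<open>b = {x, y}\<close> by auto
                then obtain L where "L \<in> cl" "w \<in> L"
                  using class_cover[of w] False simple_edge[OF biconnectedD(1)[OF bic] e(1)] by blast
                then have "w \<in> K \<or> w \<in> K'" using cl by blast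
                then show ?thesis using 3 by auto
              qed
              then show ?thesis
                using step[OF K(2), of u a w] step[OF K'(2), of v a w] K K' e unfolding A_def by auto
            qed (simp add: A_def)
          qed (simp add: A_def)
          then show False using xy class_subset[OF K(2)] class_subset[OF K'(2)] unfolding A_def by blast
        qed
        then have "crossed E x y"
          using K(3) K'(3) class_subset[OF K(2)] class_subset[OF K'(2)]
          by (intro crossedI[of u _ _ v]) auto
        then show False using \<open>\<not> crossed E x y\<close> by simp
      qed
    qed
    then have "maximal_polygons g ?C ?D" unfolding maximal_polygons_def by blast
    moreover have "splits_into g ?C ?D" using sep parts by (intro splits_into.split) auto
    ultimately show ?thesis by blast
  qed
qed

lemma decomposition_bonds:
  assumes "splits_into g C D" "maximal_polygons g C D" "biconnected g"
  shows "D = {{x, y} | x y. separating_pair g x y \<and> \<not> crossed (edges g) x y}"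
proof (intro equalityI subsetI)
  fix b assume b: "b \<in> D"
  then obtain x y where xy: "b = {x, y}" "separating_pair g x y"
    using bond_separating[OF assms(1,3)] by blast
  moreover have "\<not> crossed (edges g) x y"
    using crossed_bond_two_polygons[OF assms(1,3)] assms(2) b xy(1) unfolding maximal_polygons_def by blast
  ultimately show "b \<in> {{x, y} | x y. separating_pair g x y \<and> \<not> crossed (edges g) x y}" by blast
qed (use uncrossed_pair_bond[OF assms(1,3)] in blast)

lemma biconnected_not_K2: "biconnected g \<Longrightarrow> \<not> is_K2 g"
  by (auto simp: is_K2_def k_connected_def)

text \<open>This gives meaning to the definite description behind \<open>three_components\<close>
  and \<open>bonds\<close>.\<close>

theorem three_decomposition_unique:
  assumes "two_connected g"
  shows "\<exists>!CD. is_three_decomposition g CD"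
proof (cases "is_K2 g")
  case True
  then show ?thesis by (auto simp: is_three_decomposition_def)
next
  case False
  then have g: "biconnected g" using assms by (simp add: two_connected_def)
  have iff: "is_three_decomposition g (C, D) \<longleftrightarrow> splits_into g C D \<and> maximal_polygons g C D" for C D
    using False by (simp add: is_three_decomposition_def maximal_polygons_def)
  obtain C D where CD: "splits_into g C D" "maximal_polygons g C D" using decomposition_exists[OF g] by blast
  show ?thesis
  proof (rule ex1I[of _ "(C, D)"])
    fix CD' assume *: "is_three_decomposition g CD'"
    obtain C' D' where CD': "CD' = (C', D')" by fastforce
    then have s: "splits_into g C' D'" "maximal_polygons g C' D'" using * iff by auto
    have "D' = D" using decomposition_bonds[OF s g] decomposition_bonds[OF CD g] by simp
    then show "CD' = (C, D)" using components_determined[OF _ CD(1) g] s(1) CD' by blast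
  qed (use CD iff in blast)
qed

subsection \<open>Relabelling\<close>

lemma verts_relabel [simp]: "verts (relabel f g) = f ` verts g"
  and edges_relabel [simp]: "edges (relabel f g) = (\<lambda>e. f ` e) ` edges g"
  by (simp_all add: relabel_def)

lemma relabel_comp: "relabel (h \<circ> f) g = relabel h (relabel f g)"
  by (simp add: relabel_def image_comp comp_def)

lemma relabel_id [simp]: "relabel id g = g"
  by (cases g) (simp add: relabel_def)

lemma relabel_cong:
  assumes "simple_graph g" "\<And>x. x \<in> verts g \<Longrightarrow> f x = f' x"
  shows "relabel f g = relabel f' g"
proof -
  have "f ` e = f' ` e" if "e \<in> edges g" for e
    using that assms by (intro image_cong) (auto simp: simple_graph_def)
  then show ?thesis using assms(2) by (auto simp: relabel_def intro!: image_cong)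
qed

context
  fixes f :: "'v \<Rightarrow> 'w"
  assumes bij: "bij f"
begin

lemma inj_relabelling: "inj f"
  using bij by (rule bij_is_inj)

lemma relabel_inv: "relabel (inv f) (relabel f g) = g"
  using inj_relabelling by (simp add: relabel_comp[symmetric])

lemma inj_relabel: "inj (relabel f)"
  by (metis injI relabel_inv)

lemma image_edge_iff: "{f u, f v} \<in> (\<lambda>e. f ` e) ` E \<longleftrightarrow> {u, v} \<in> E"
proof -
  have "f ` {u, v} \<in> (\<lambda>e. f ` e) ` E \<longleftrightarrow> {u, v} \<in> E"
    by (simp add: image_iff inj_image_eq_iff[OF inj_relabelling] del: image_insert)
  then show ?thesis by simp
qed

lemma reach_relabel: "reach ((\<lambda>e. f ` e) ` E) (f ` S) (f a) (f b) \<longleftrightarrow> reach E S a b"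
proof
  assume "reach ((\<lambda>e. f ` e) ` E) (f ` S) (f a) (f b)"
  then have "f b \<in> {c. \<forall>w. c = f w \<longrightarrow> reach E S a w}"
  proof (rule reach_closed)
    show "f a \<in> {c. \<forall>w. c = f w \<longrightarrow> reach E S a w}" using inj_relabelling by (simp add: inj_eq)
    fix u' v' assume u': "u' \<in> {c. \<forall>w. c = f w \<longrightarrow> reach E S a w}"
      and e: "{u', v'} \<in> (\<lambda>e. f ` e) ` E" "u' \<notin> f ` S" "v' \<notin> f ` S"
    obtain u v where uv: "u' = f u" "v' = f v" using bij by (metis bij_pointE)
    then have "{u, v} \<in> E" "u \<notin> S" "v \<notin> S" using e image_edge_iff[of u v E] by auto
    then have "reach E S u v" by (rule reach_edge)
    then have "reach E S a v" using u' uv reach_trans[of E S a u v] by blast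
    then show "v' \<in> {c. \<forall>w. c = f w \<longrightarrow> reach E S a w}"
      using uv inj_relabelling by (simp add: inj_eq)
  qed
  then show "reach E S a b" by blast
next
  assume "reach E S a b"
  then have "b \<in> {w. reach ((\<lambda>e. f ` e) ` E) (f ` S) (f a) (f w)}"
  proof (rule reach_closed)
    fix u v assume u: "u \<in> {w. reach ((\<lambda>e. f ` e) ` E) (f ` S) (f a) (f w)}"
      and e: "{u, v} \<in> E" "u \<notin> S" "v \<notin> S"
    have "reach ((\<lambda>e. f ` e) ` E) (f ` S) (f u) (f v)"
      using e inj_relabelling by (intro reach_edge) (simp_all add: image_edge_iff inj_image_mem_iff)
    then show "v \<in> {w. reach ((\<lambda>e. f ` e) ` E) (f ` S) (f a) (f w)}"
      using u reach_trans[of _ _ "f a" "f u" "f v"] by blast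
  qed simp
  then show "reach ((\<lambda>e. f ` e) ` E) (f ` S) (f a) (f b)" by simp
qed

lemma image_Diff_bij: "f ` A - f ` B = f ` (A - B)"
  using inj_relabelling by (simp add: image_set_diff)

lemma connected_delete_relabel:
  "connected_graph (delete_verts (relabel f g) (f ` S)) \<longleftrightarrow> connected_graph (delete_verts g S)"
  unfolding connected_delete_iff by (simp add: image_Diff_bij reach_relabel)

lemma card_image_bij: "card (f ` A) = card A"
  by (rule card_image) (rule inj_on_subset[OF inj_relabelling subset_UNIV])

lemma simple_graph_relabel: "simple_graph g \<Longrightarrow> simple_graph (relabel f g)"
  by (auto simp: simple_graph_def card_image_bij)

lemma k_connected_relabel:
  assumes "k_connected k g"
  shows "k_connected k (relabel f g)"
  unfolding k_connected_def
proof (intro conjI allI impI)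
  fix S assume S: "S \<subseteq> verts (relabel f g)" "card S < k"
  then obtain S' where "S' \<subseteq> verts g" "S = f ` S'" by (auto simp: subset_image_iff)
  then show "connected_graph (delete_verts (relabel f g) S)"
    using assms S connected_delete_relabel[of g S'] by (simp add: k_connected_def card_image_bij)
qed (use assms in \<open>simp_all add: k_connected_def card_image_bij simple_graph_relabel\<close>)

lemma is_K2_relabel:
  assumes "is_K2 g"
  shows "is_K2 (relabel f g)"
proof -
  obtain x y where "x \<noteq> y" "g = UGraph {x, y} {{x, y}}" using assms by (auto simp: is_K2_def)
  then have "f x \<noteq> f y" "relabel f g = UGraph {f x, f y} {{f x, f y}}"
    using inj_relabelling by (auto simp: relabel_def inj_eq)
  then show ?thesis unfolding is_K2_def by blast
qed

lemma two_connected_relabel: "two_connected g \<Longrightarrow> two_connected (relabel f g)"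
  using k_connected_relabel is_K2_relabel by (auto simp: two_connected_def)

lemma path_edges_map: "path_edges (map f vs) = (\<lambda>e. f ` e) ` path_edges vs"
  by (induction vs rule: path_edges.induct) auto

lemma polygon_relabel:
  assumes "polygon g"
  shows "polygon (relabel f g)"
proof -
  obtain vs where vs: "distinct vs" "3 \<le> length vs" "g = UGraph (set vs) (cycle_edges vs)"
    using assms unfolding polygon_iff by blast
  then have "vs \<noteq> []" by auto
  then have "cycle_edges (map f vs) = (\<lambda>e. f ` e) ` cycle_edges vs"
    by (simp add: cycle_edges_def path_edges_map last_map hd_map)
  then have "relabel f g = UGraph (set (map f vs)) (cycle_edges (map f vs))"
    using vs by (simp add: relabel_def)
  moreover have "distinct (map f vs)" using vs inj_relabelling by (simp add: distinct_map inj_on_def)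
  ultimately show ?thesis using vs(2) unfolding polygon_iff by (intro exI[of _ "map f vs"]) simp
qed

lemma separating_pair_relabel:
  assumes "separating_pair g x y"
  shows "separating_pair (relabel f g) (f x) (f y)"
  using assms connected_delete_relabel[of g "{x, y}"] inj_relabelling
  by (simp add: separating_pair_def inj_eq)

lemma pieces_relabel: "pieces (relabel f g) (f x) (f y) = relabel f ` pieces g x y"
proof -
  have cc: "connected_classes (delete_verts (relabel f g) {f x, f y}) =
      (\<lambda>K. f ` K) ` connected_classes (delete_verts g {x, y})"
  proof -
    have *: "{v \<in> f ` (verts g - {x, y}). reach ((\<lambda>e. f ` e) ` edges g) (f ` {x, y}) (f u) v} =
        f ` {v \<in> verts g - {x, y}. reach (edges g) {x, y} u v}" for u
      using reach_relabel[of "edges g" "{x, y}" u] by blast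
    have "verts (relabel f g) - {f x, f y} = f ` (verts g - {x, y})"
      using image_Diff_bij[of "verts g" "{x, y}"] by simp
    then show ?thesis
      unfolding connected_classes_delete using * by (simp add: image_image)
  qed
  have edges: "{e \<in> (\<lambda>e. f ` e) ` edges g. e \<subseteq> f ` K \<union> {f x, f y}} =
      (\<lambda>e. f ` e) ` {e \<in> edges g. e \<subseteq> K \<union> {x, y}}" for K
  proof -
    have "f ` e \<subseteq> f ` K \<union> {f x, f y} \<longleftrightarrow> e \<subseteq> K \<union> {x, y}" for e
      using inj_image_subset_iff[OF inj_relabelling, of e "K \<union> {x, y}"] by (simp add: image_Un)
    then show ?thesis by auto
  qed
  show ?thesis
    unfolding pieces_def cc image_image
    by (intro image_cong refl) (simp only: edges_relabel edges, simp add: relabel_def image_Un)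
qed

lemma linked_relabel: "linked (relabel f ` C) (f ` b) = relabel f ` linked C b"
  using inj_relabelling by (auto simp: linked_def inj_image_eq_iff)

end

lemma relabel_iff:
  assumes "bij (f :: 'v \<Rightarrow> 'w)"
  shows "k_connected k (relabel f g) \<longleftrightarrow> k_connected k g" "is_K2 (relabel f g) \<longleftrightarrow> is_K2 g"
    "polygon (relabel f g) \<longleftrightarrow> polygon g"
  using k_connected_relabel[of f k g] k_connected_relabel[of "inv f" k "relabel f g"]
    is_K2_relabel[of f g] is_K2_relabel[of "inv f" "relabel f g"]
    polygon_relabel[of f g] polygon_relabel[of "inv f" "relabel f g"]
    relabel_inv[OF assms, of g] bij_imp_bij_inv[OF assms] assms by auto

lemma splits_into_relabel:
  assumes "splits_into g C D" "bij f"
  shows "splits_into (relabel f g) (relabel f ` C) ((\<lambda>b. f ` b) ` D)"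
  using assms(1)
proof (induction rule: splits_into.induct)
  case (stop g)
  then show ?case using relabel_iff[OF assms(2)] by (simp add: splits_into.stop)
next
  case (split g x y C D)
  \<comment> \<open>The rule \<open>split\<close> takes the parts as functions of the piece; for a
    relabelled piece they are found by going back along the inverse of \<open>f\<close>.\<close>
  define C' where "C' p = relabel f ` C (relabel (inv f) p)" for p
  define D' where "D' p = (\<lambda>b. f ` b) ` D (relabel (inv f) p)" for p
  have CD: "C' (relabel f p) = relabel f ` C p" "D' (relabel f p) = (\<lambda>b. f ` b) ` D p" for p
    by (simp_all add: C'_def D'_def relabel_inv[OF assms(2)])
  have "splits_into (relabel f g) (\<Union>p\<in>pieces (relabel f g) (f x) (f y). C' p)
      (insert {f x, f y} (\<Union>p\<in>pieces (relabel f g) (f x) (f y). D' p))"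
    using split separating_pair_relabel[OF assms(2)]
    by (intro splits_into.split) (auto simp: pieces_relabel[OF assms(2)] CD)
  then show ?case by (simp add: pieces_relabel[OF assms(2)] CD image_UN)
qed

lemma is_three_decomposition_relabel:
  assumes "is_three_decomposition g (C, D)" "bij f"
  shows "is_three_decomposition (relabel f g) (relabel f ` C, (\<lambda>b. f ` b) ` D)"
proof (cases "is_K2 g")
  case True
  then show ?thesis using assms by (simp add: is_three_decomposition_def relabel_iff(2))
next
  case False
  have inj: "inj f" using assms(2) by (rule bij_is_inj)
  have "card (linked (relabel f ` C) (f ` b)) = card (linked C b)" for b
    unfolding linked_relabel[OF assms(2)]
    by (rule card_image) (rule inj_on_subset[OF inj_relabel[OF assms(2)] subset_UNIV])
  moreover have "f ` b \<in> edges (relabel f g) \<longleftrightarrow> b \<in> edges g" for b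
    using inj by (auto simp: inj_image_eq_iff)
  moreover have "(\<forall>c\<in>linked (relabel f ` C) (f ` b). polygon c) \<longleftrightarrow> (\<forall>c\<in>linked C b. polygon c)" for b
    by (simp add: linked_relabel[OF assms(2)] relabel_iff(3)[OF assms(2)])
  ultimately have "(f ` b \<notin> edges (relabel f g) \<and> card (linked (relabel f ` C) (f ` b)) = 2 \<and>
      (\<forall>c\<in>linked (relabel f ` C) (f ` b). polygon c)) \<longleftrightarrow>
      (b \<notin> edges g \<and> card (linked C b) = 2 \<and> (\<forall>c\<in>linked C b. polygon c))" for b
    by (simp del: edges_relabel)
  then have "(\<exists>b\<in>(\<lambda>b. f ` b) ` D. b \<notin> edges (relabel f g) \<and> card (linked (relabel f ` C) b) = 2 \<and>
      (\<forall>c\<in>linked (relabel f ` C) b. polygon c)) \<longleftrightarrow>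
      (\<exists>b\<in>D. b \<notin> edges g \<and> card (linked C b) = 2 \<and> (\<forall>c\<in>linked C b. polygon c))"
    unfolding bex_simps(7) by blast
  then show ?thesis
    using assms(1) False splits_into_relabel[OF _ assms(2), of g C D]
    unfolding is_three_decomposition_def by (simp only: prod.case relabel_iff(2)[OF assms(2)] if_False) blast
qed

lemma is_three_decomposition_the:
  "two_connected g \<Longrightarrow> is_three_decomposition g (three_components g, bonds g)"
  using theI'[OF three_decomposition_unique]
  by (simp add: three_decomposition_def three_components_def bonds_def)

lemma three_decomposition_eq:
  assumes "two_connected g" "is_three_decomposition g (C, D)"
  shows "three_components g = C" "bonds g = D"
  using three_decomposition_unique[OF assms(1)] is_three_decomposition_the[OF assms(1)] assms(2)
  by blast+

lemma three_decomposition_relabel: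
  assumes "two_connected g" "bij f"
  shows "three_components (relabel f g) = relabel f ` three_components g"
    "bonds (relabel f g) = (\<lambda>b. f ` b) ` bonds g"
  using three_decomposition_eq[OF two_connected_relabel[OF assms(2,1)]
      is_three_decomposition_relabel[OF is_three_decomposition_the[OF assms(1)] assms(2)]] by simp_all

subsection \<open>Rooting the tree of a 2-connected graph\<close>

definition nodes :: "'v ugraph \<Rightarrow> ('v ugraph + 'v set) set" where
  "nodes g = three_components g <+> bonds g"

definition incidences :: "'v ugraph \<Rightarrow> ('v ugraph \<times> 'v set) set" where
  "incidences g = {(c, b). b \<in> bonds g \<and> c \<in> linked (three_components g) b}"

lemma tc_edge_iff: "{Inl c, Inr b} \<in> edges (tc g) \<longleftrightarrow> (c, b) \<in> incidences g"
  by (auto simp: tc_def incidences_def doubleton_eq_iff)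

text \<open>For a component \<open>c\<close> linked by a bond \<open>b\<close> this is the vertex
  set of a single connected component of \<open>g\<close> without \<open>b\<close>, because
  \<open>b\<close> does not separate \<open>c\<close>.\<close>

definition side :: "'v ugraph \<Rightarrow> 'v ugraph \<Rightarrow> 'v set \<Rightarrow> 'v set" where
  "side g c b = {w \<in> verts g - b. \<exists>a\<in>verts c - b. reach (edges g) b a w}"

text \<open>Ties go to the component. At a component the comparison of two incident bonds has
  strictness to spare, whereas a bond may link two components of equal weight that fill the graph,
  and sending both incidences to the bond would break injectivity.\<close>

fun lighter_end :: "'v ugraph \<Rightarrow> 'v ugraph \<times> 'v set \<Rightarrow> 'v ugraph + 'v set" where
  "lighter_end g (c, b) =
     (if card (side g c b) \<le> card (verts g - b - side g c b) then Inl c else Inr b)"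

definition root :: "'v ugraph \<Rightarrow> 'v ugraph + 'v set" where
  "root g = (THE v. v \<in> nodes g - lighter_end g ` incidences g)"

context
  fixes g :: "'v ugraph"
  assumes bic: "biconnected g"
begin

lemma biconnected_two_connected: "two_connected g"
  using bic by (simp add: two_connected_def)

lemma the_splits: "splits_into g (three_components g) (bonds g)"
  using is_three_decomposition_the[OF biconnected_two_connected] biconnected_not_K2[OF bic]
  by (simp add: is_three_decomposition_def)

lemma incidence_facts:
  assumes "(c, b) \<in> incidences g"
  shows "b \<in> bonds g" "c \<in> three_components g" "b \<in> edges c" "b \<subseteq> verts c" "card b = 2"
    "verts c \<subseteq> verts g" "verts c - b \<noteq> {}" "verts c - b \<subseteq> side g c b"
proof -
  show bc: "b \<in> bonds g" "c \<in> three_components g" "b \<in> edges c"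
    using assms by (auto simp: incidences_def linked_def)
  note c = component_facts[OF the_splits bic bc(2)]
  show b: "b \<subseteq> verts c" "card b = 2" using simple_edge_subset[OF c(1) bc(3)] by auto
  show "verts c \<subseteq> verts g" by (rule c)
  show "verts c - b \<noteq> {}"
  proof
    assume "verts c - b = {}"
    then have "card (verts c) \<le> card b"
      using card_mono[of b "verts c"] b(2) by (metis Diff_eq_empty_iff card.infinite zero_neq_numeral)
    then show False using biconnectedD(3)[OF c(1)] b(2) by simp
  qed
  show "verts c - b \<subseteq> side g c b" 
  proof
    fix w assume "w \<in> verts c - b"
    moreover have "reach (edges g) b w w" by simp
    ultimately show "w \<in> side g c b" using c(2) unfolding side_def by blast
  qed
qed

lemma finite_nodes: "finite (three_components g)" "finite (bonds g)"
  using finite_splits[OF the_splits bic] by auto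

lemma card_incidences: "card (nodes g) = Suc (card (incidences g))"
proof -
  have "incidences g = (\<lambda>(b, c). (c, b)) ` (SIGMA b:bonds g. linked (three_components g) b)"
    by (auto simp: incidences_def)
  moreover have "inj_on (\<lambda>(b, c). (c, b)) (SIGMA b:bonds g. linked (three_components g) b)"
    by (auto simp: inj_on_def)
  ultimately have "card (incidences g) = card (SIGMA b:bonds g. linked (three_components g) b)"
    by (simp add: card_image)
  also have "\<dots> = (\<Sum>b\<in>bonds g. card (linked (three_components g) b))"
    using finite_nodes by (intro card_SigmaI) (auto simp: linked_def)
  finally show ?thesis
    using tree_count[OF the_splits bic] finite_nodes by (simp add: nodes_def card_Plus)
qed

text \<open>Let \<open>w\<close> lie behind both bonds as seen from \<open>c\<close>. A walk from
  \<open>w\<close> first meets \<open>c\<close> in a vertex of \<open>b\<close> and of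
  \<open>b'\<close>, since otherwise \<open>w\<close> would be on the side of \<open>c\<close>. By
  2-connectedness such an entrance exists after deleting any one vertex other than \<open>w\<close>,
  so the two bonds share two vertices and coincide.\<close>

lemma far_sides_disjoint:
  assumes "(c, b) \<in> incidences g" "(c, b') \<in> incidences g" "b \<noteq> b'"
  shows "(verts g - b - side g c b) \<inter> (verts g - b' - side g c b') = {}"
proof (rule ccontr)
  assume "\<not> ?thesis"
  then obtain w where w: "w \<in> verts g" "w \<notin> b" "w \<notin> b'" "w \<notin> side g c b" "w \<notin> side g c b'" by blast
  have wc: "w \<notin> verts c" using w incidence_facts(8)[OF assms(1)] by blast
  have hit: "z \<in> b'" if "(c, b') \<in> incidences g" "w \<notin> b'" "w \<notin> side g c b'" "z \<in> verts c"
    "reach (edges g) (verts c - {z}) w z" for z b'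
  proof (rule ccontr)
    assume z: "z \<notin> b'"
    have "reach (edges g) b' w z"
      by (rule reach_mono[OF that(5)]) (use z incidence_facts(4)[OF that(1)] in auto)
    then have "reach (edges g) b' z w" by (rule reach_sym)
    then have "w \<in> side g c b'" using w(1) that z by (auto simp: side_def)
    then show False using that by simp
  qed
  have exit: "\<exists>z'\<in>b \<inter> b'. z' \<noteq> z" if "z \<noteq> w" for z
  proof -
    have "\<not> verts c \<subseteq> {z}"
      using biconnectedD(3)[of c] component_facts(1)[OF the_splits bic incidence_facts(2)[OF assms(1)]]
        card_mono[of "{z}" "verts c"] by auto
    then obtain t where t: "t \<in> verts c" "t \<noteq> z" by blast
    have "reach (edges g) {z} w t"
      using t w(1) that incidence_facts(6)[OF assms(1)] by (intro biconnected_reach[OF bic]) auto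
    then obtain z' where z': "z' \<in> verts c" "z' \<notin> {z}" "reach (edges g) (verts c - {z'}) w z'"
      using reach_first_hit[OF _ t(1) wc] by metis
    then have "z' \<in> b \<inter> b'" using hit[OF assms(1) w(2,4)] hit[OF assms(2) w(3,5)] by blast
    then show ?thesis using z'(2) by blast
  qed
  obtain t where "t \<in> verts c" using incidence_facts(7)[OF assms(1)] by blast
  then have "t \<noteq> w" using wc by auto
  then obtain z where z: "z \<in> b \<inter> b'" using exit by blast
  then have "z \<noteq> w" using w by blast
  then obtain z' where z': "z' \<in> b \<inter> b'" "z' \<noteq> z" using exit by blast
  have "{z, z'} = d" if "z \<in> d" "z' \<in> d" "card d = 2" for d
    using that z'(2) by (intro card_subset_eq card_ge_0_finite) auto
  then have "b = b'" using z z' incidence_facts(5)[OF assms(1)] incidence_facts(5)[OF assms(2)] by blast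
  then show False using assms(3) by simp
qed

text \<open>At a component, the far side of one bond lies strictly inside the near side of the
  other, as it misses \<open>c\<close>. At a bond, the near side of one component lies inside the
  far side of the other. In both cases two incidences sent to the same node would give a cyclic
  chain of inequalities, one of them strict.\<close>

lemma lighter_end_inj: "inj_on (lighter_end g) (incidences g)"
proof -
  let ?far = "\<lambda>c b. verts g - b - side g c b"
  have fin: "finite (side g c b)" "finite (?far c b)" for c b
    using biconnectedD(2)[OF bic] by (auto simp: side_def)
  have bond: "b = b'" if I: "(c, b) \<in> incidences g" "(c, b') \<in> incidences g"
    and le: "card (side g c b) \<le> card (?far c b)" "card (side g c b') \<le> card (?far c b')" for c b b'
  proof (rule ccontr)
    assume ne: "b \<noteq> b'"
    have less: "card (?far c b) < card (side g c b')"
      if I: "(c, b) \<in> incidences g" "(c, b') \<in> incidences g" "b \<noteq> b'" for b b'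
    proof (rule psubset_card_mono[OF fin(1)])
      have far: "?far c b \<inter> verts c = {}" using incidence_facts(8)[OF I(1)] by blast
      then have "?far c b \<subseteq> side g c b'"
        using far_sides_disjoint[OF I] incidence_facts(4)[OF I(2)] by blast
      then show "?far c b \<subset> side g c b'"
        using far incidence_facts(7,8)[OF I(2)] by blast
    qed
    show False using less[OF I ne] less[OF I(2,1) ne[symmetric]] le by simp
  qed
  have comp: "c = c'" if I: "(c, b) \<in> incidences g" "(c', b) \<in> incidences g"
    and gt: "card (?far c b) < card (side g c b)" "card (?far c' b) < card (side g c' b)" for c c' b
  proof (rule ccontr)
    assume ne: "c \<noteq> c'"
    have "side g c b \<inter> side g c' b = {}"
    proof (rule ccontr)
      assume "\<not> ?thesis"
      then obtain w a a' where w: "a \<in> verts c - b" "reach (edges g) b a w"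
        "a' \<in> verts c' - b" "reach (edges g) b a' w" unfolding side_def by blast
      have "reach (edges g) b a a'" by (rule reach_trans[OF w(2) reach_sym[OF w(4)]])
      then have "c = c'"
        using linked_distinct_sides[OF the_splits bic, rule_format, of b c c' a a'] w I
        by (simp add: incidences_def)
      then show False using ne by simp
    qed
    then have "side g c b \<subseteq> ?far c' b" "side g c' b \<subseteq> ?far c b" by (auto simp: side_def)
    then have "card (side g c b) \<le> card (?far c' b)" "card (side g c' b) \<le> card (?far c b)"
      using fin by (auto intro: card_mono)
    then show False using gt by simp
  qed
  show ?thesis
  proof (rule inj_onI, clarify)
    fix c b c' b'
    assume "(c, b) \<in> incidences g" "(c', b') \<in> incidences g" "lighter_end g (c, b) = lighter_end g (c', b')"
    then show "c = c' \<and> b = b'" using bond[of c b b'] comp[of c b c'] by (auto split: if_splits)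
  qed
qed

lemma lighter_end_nodes: "lighter_end g ` incidences g \<subseteq> nodes g"
  by (auto simp: nodes_def incidences_def linked_def)

lemma root_unique: "\<exists>!v. v \<in> nodes g - lighter_end g ` incidences g"
proof -
  have "finite (nodes g)" using finite_nodes by (simp add: nodes_def)
  then have "card (nodes g - lighter_end g ` incidences g) = 1"
    using card_incidences lighter_end_nodes lighter_end_inj
    by (simp add: card_Diff_subset finite_subset card_image)
  then obtain v where "nodes g - lighter_end g ` incidences g = {v}" by (rule card_1_singletonE)
  then show ?thesis by simp
qed

lemma root_in: "root g \<in> nodes g - lighter_end g ` incidences g"
  unfolding root_def by (rule theI'[OF root_unique])

lemma nodes_eq: "nodes g = insert (root g) (lighter_end g ` incidences g)"
  using root_unique root_in lighter_end_nodes by blast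

end

lemma side_relabel:
  assumes "bij f"
  shows "side (relabel f g) (relabel f c) (f ` b) = f ` side g c b"
  using reach_relabel[OF assms] unfolding side_def
  by (simp add: image_Diff_bij[OF assms]) blast

lemma lighter_end_relabel:
  assumes "bij f"
  shows "lighter_end (relabel f g) (relabel f c, f ` b) =
    map_sum (relabel f) (image f) (lighter_end g (c, b))"
  by (simp add: side_relabel[OF assms] image_Diff_bij[OF assms] card_image_bij[OF assms])

lemma incidences_relabel:
  assumes "two_connected g" "bij f"
  shows "incidences (relabel f g) = map_prod (relabel f) (image f) ` incidences g"
proof -
  have "(c, b) \<in> incidences (relabel f g) \<longleftrightarrow> (c, b) \<in> map_prod (relabel f) (image f) ` incidences g" for c b
    unfolding incidences_def three_decomposition_relabel[OF assms]
    using linked_relabel[OF assms(2)] by fastforce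
  then show ?thesis by auto
qed

text \<open>Relabelling carries nodes to nodes and lighter ends to lighter ends, so it carries the
  one missed node to the one missed node.\<close>

lemma root_relabel:
  assumes "biconnected g" "bij f"
  shows "root (relabel f g) = map_sum (relabel f) (image f) (root g)"
proof -
  have tc: "two_connected g" using assms(1) by (rule biconnected_two_connected)
  let ?m = "map_sum (relabel f) (image f)"
  have inj: "inj ?m"
    using inj_relabel[OF assms(2)] inj_image_eq_iff[OF bij_is_inj[OF assms(2)]]
    by (intro sum.inj_map injI) (auto dest: injD)
  have nodes: "nodes (relabel f g) = ?m ` nodes g"
    unfolding nodes_def three_decomposition_relabel[OF tc assms(2)] Plus_def by (auto simp: image_Un image_image)
  have ends: "lighter_end (relabel f g) ` incidences (relabel f g) = ?m ` lighter_end g ` incidences g"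
    unfolding incidences_relabel[OF tc assms(2)] image_image
    by (rule image_cong) (auto simp: lighter_end_relabel[OF assms(2)] simp del: lighter_end.simps)
  have "?m (root g) \<in> nodes (relabel f g) - lighter_end (relabel f g) ` incidences (relabel f g)"
    unfolding nodes ends using root_in[OF assms(1)] inj by (auto simp: inj_image_mem_iff)
  then show ?thesis
    using root_unique[OF k_connected_relabel[OF assms(2,1)]] root_in[OF k_connected_relabel[OF assms(2,1)]]
    by blast
qed

subsection \<open>Species of rooted graphs\<close>

text \<open>Species transport along bijections of finite sets, whereas the relabelling lemmas speak
  of bijections of the whole type. The sets \<open>V - U\<close> and \<open>U - V\<close> have equal
  size, so matching them and fixing all else bridges the gap.\<close>

lemma bij_betw_extend:
  fixes f :: "'v \<Rightarrow> 'v"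
  assumes "finite U" "bij_betw f U V"
  obtains f' where "bij f'" "\<And>x. x \<in> U \<Longrightarrow> f' x = f x"
proof -
  have "finite V" "card U = card V"
    using assms bij_betw_finite bij_betw_same_card by blast+
  then have "card (V - U) = card (U - V)"
    using assms(1) by (simp add: card_Diff_subset_Int Int_commute)
  then obtain h where h: "bij_betw h (V - U) (U - V)"
    using finite_same_card_bij[of "V - U" "U - V"] assms(1) \<open>finite V\<close> by blast
  define f' where "f' x = (if x \<in> U then f x else if x \<in> V then h x else x)" for x
  have "bij_betw f' U V" using assms(2) by (rule bij_betw_cong[THEN iffD1, rotated]) (simp add: f'_def)
  moreover have "bij_betw f' (V - U) (U - V)"
    using h by (rule bij_betw_cong[THEN iffD1, rotated]) (simp add: f'_def)
  ultimately have "bij_betw f' (U \<union> (V - U)) (V \<union> (U - V))" by (rule bij_betw_combine) blast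
  moreover have "bij_betw f' (- (U \<union> V)) (- (U \<union> V))"
    by (rule bij_betw_cong[THEN iffD1, OF _ bij_betw_id]) (simp add: f'_def)
  ultimately have "bij_betw f' (U \<union> (V - U) \<union> - (U \<union> V)) (V \<union> (U - V) \<union> - (U \<union> V))"
    by (rule bij_betw_combine) blast
  moreover have "U \<union> (V - U) \<union> - (U \<union> V) = UNIV" "V \<union> (U - V) \<union> - (U \<union> V) = UNIV" by blast+
  ultimately have "bij f'" by simp
  then show thesis by (rule that) (simp add: f'_def)
qed

lemma finite_simple_graphs:
  assumes "finite U"
  shows "finite {g. simple_graph g \<and> verts g = U}"
proof (rule finite_subset)
  show "{g. simple_graph g \<and> verts g = U} \<subseteq> UGraph U ` Pow (Pow U)"
  proof
    fix g assume "g \<in> {g. simple_graph g \<and> verts g = U}"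
    then show "g \<in> UGraph U ` Pow (Pow U)" by (cases g) (auto simp: simple_graph_def)
  qed
qed (use assms in simp)

lemma is_speciesD:
  assumes "is_species S" "finite U"
  shows "finite (structs S U)"
    and "bij_betw f U V \<Longrightarrow> s \<in> structs S U \<Longrightarrow> transport S U f s \<in> structs S V"
    and "(\<And>x. x \<in> U \<Longrightarrow> f x = x) \<Longrightarrow> s \<in> structs S U \<Longrightarrow> transport S U f s = s"
  using assms by (simp_all add: is_species_def)

lemma is_species_comp:
  assumes "is_species S" "finite U" "bij_betw f U V" "bij_betw g V W" "\<And>x. x \<in> U \<Longrightarrow> h x = g (f x)"
    and "s \<in> structs S U"
  shows "transport S U h s = transport S V g (transport S U f s)"
proof -
  have "\<forall>U V W f g h. finite U \<longrightarrow> bij_betw f U V \<longrightarrow> bij_betw g V W \<longrightarrow> (\<forall>x\<in>U. h x = g (f x)) \<longrightarrow>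
      (\<forall>s\<in>structs S U. transport S U h s = transport S V g (transport S U f s))"
    using assms(1) unfolding is_species_def by (elim conjE)
  from this[rule_format, OF assms(2-6)] show ?thesis .
qed

lemma is_species_sum:
  assumes "is_species S" "is_species T"
  shows "is_species (S +\<^sub>S T)"
  unfolding is_species_def species_sum_def species.simps
proof (intro conjI allI impI ballI)
  fix U :: "'a set" assume "finite U"
  then show "finite (structs S U <+> structs T U)" using assms by (simp add: is_speciesD(1))
next
  fix U V and f :: "'a \<Rightarrow> 'a" and s
  assume "finite U" "bij_betw f U V" "s \<in> structs S U <+> structs T U"
  then show "map_sum (transport S U f) (transport T U f) s \<in> structs S V <+> structs T V"
    using assms by (auto simp: is_speciesD(2))
next
  fix U and f :: "'a \<Rightarrow> 'a" and s
  assume "finite U" "\<forall>x\<in>U. f x = x" "s \<in> structs S U <+> structs T U"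
  then show "map_sum (transport S U f) (transport T U f) s = s"
    using assms by (auto simp: is_speciesD(3))
next
  fix U V W and f g h :: "'a \<Rightarrow> 'a" and s
  assume *: "finite U" "bij_betw f U V" "bij_betw g V W" "\<forall>x\<in>U. h x = g (f x)"
    and "s \<in> structs S U <+> structs T U"
  then show "map_sum (transport S U h) (transport T U h) s =
      map_sum (transport S V g) (transport T V g) (map_sum (transport S U f) (transport T U f) s)"
    using is_species_comp[OF assms(1) *(1-3), of h] is_species_comp[OF assms(2) *(1-3), of h] by auto
qed

lemma is_species_graphs:
  assumes simple: "\<And>g. g \<in> A \<Longrightarrow> simple_graph g"
    and closed: "\<And>g f. g \<in> A \<Longrightarrow> bij f \<Longrightarrow> relabel f g \<in> A"
  shows "is_species (graph_species A)"
  unfolding is_species_def graph_species_def species.simps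
proof (intro conjI allI impI ballI)
  fix U :: "'a set" assume "finite U"
  then show "finite {g \<in> A. verts g = U}"
    by (rule finite_subset[OF _ finite_simple_graphs, rotated]) (use simple in auto)
next
  fix U V and f :: "'a \<Rightarrow> 'a" and g
  assume U: "finite U" "bij_betw f U V" and g: "g \<in> {g \<in> A. verts g = U}"
  obtain f' where f': "bij f'" "\<And>x. x \<in> U \<Longrightarrow> f' x = f x" using bij_betw_extend[OF U] by blast
  then have "relabel f g = relabel f' g" using g by (intro relabel_cong simple) auto
  then show "relabel f g \<in> {g \<in> A. verts g = V}"
    using g U(2) closed[OF _ f'(1)] f'(2) by (auto simp: bij_betw_def)
next
  fix U and f :: "'a \<Rightarrow> 'a" and g
  assume "\<forall>x\<in>U. f x = x" "g \<in> {g \<in> A. verts g = U}"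
  then show "relabel f g = g" using relabel_cong[of g f id] simple by simp
next
  fix U V W and f k h :: "'a \<Rightarrow> 'a" and g
  assume "\<forall>x\<in>U. h x = k (f x)" "g \<in> {g \<in> A. verts g = U}"
  then show "relabel h g = relabel k (relabel f g)"
    using relabel_cong[of g h "k \<circ> f"] simple by (simp add: relabel_comp)
qed

text \<open>The common form of all three rooted species: \<open>R g\<close> is the set of admissible
  roots and \<open>act\<close> relabels a root.\<close>

definition rooted_species ::
  "'v ugraph set \<Rightarrow> ('v ugraph \<Rightarrow> 'r set) \<Rightarrow> (('v \<Rightarrow> 'v) \<Rightarrow> 'r \<Rightarrow> 'r) \<Rightarrow> ('v, 'v ugraph \<times> 'r) species" where
  "rooted_species A R act =
     \<lparr>structs = (\<lambda>U. {(g, r). g \<in> A \<and> verts g = U \<and> r \<in> R g}),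
      transport = (\<lambda>U f (g, r). (relabel f g, act f r))\<rparr>"

text \<open>The assumption \<open>cong\<close> says that a root is relabelled only through the
  vertices of its graph. Hence a bijection of finite sets may be exchanged for its extension to the
  type, to which \<open>closed\<close> and \<open>roots\<close> apply.\<close>

lemma is_species_rooted:
  assumes simple: "\<And>g. g \<in> A \<Longrightarrow> simple_graph g"
    and closed: "\<And>g f. g \<in> A \<Longrightarrow> bij f \<Longrightarrow> relabel f g \<in> A"
    and fin: "\<And>g. g \<in> A \<Longrightarrow> finite (R g)"
    and roots: "\<And>g f r. g \<in> A \<Longrightarrow> bij f \<Longrightarrow> r \<in> R g \<Longrightarrow> act f r \<in> R (relabel f g)"
    and cong: "\<And>g f f' r. g \<in> A \<Longrightarrow> r \<in> R g \<Longrightarrow> (\<And>x. x \<in> verts g \<Longrightarrow> f x = f' x) \<Longrightarrow> act f r = act f' r"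
    and act: "\<And>r. act id r = r" "\<And>f k r. act (k \<circ> f) r = act k (act f r)"
  shows "is_species (rooted_species A R act)"
  unfolding is_species_def rooted_species_def species.simps
proof (intro conjI allI impI ballI)
  fix U :: "'a set" assume "finite U"
  then have "finite {g \<in> A. verts g = U}"
    by (rule finite_subset[OF _ finite_simple_graphs, rotated]) (use simple in auto)
  then have "finite (SIGMA g:{g \<in> A. verts g = U}. R g)" using fin by (intro finite_SigmaI) auto
  moreover have "{(g, r). g \<in> A \<and> verts g = U \<and> r \<in> R g} = (SIGMA g:{g \<in> A. verts g = U}. R g)" by auto
  ultimately show "finite {(g, r). g \<in> A \<and> verts g = U \<and> r \<in> R g}" by simp
next
  fix U V and f :: "'a \<Rightarrow> 'a" and s
  assume U: "finite U" "bij_betw f U V" and s: "s \<in> {(g, r). g \<in> A \<and> verts g = U \<and> r \<in> R g}"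
  obtain g r where gr: "s = (g, r)" "g \<in> A" "verts g = U" "r \<in> R g" using s by blast
  obtain f' where f': "bij f'" "\<And>x. x \<in> U \<Longrightarrow> f' x = f x" using bij_betw_extend[OF U] by blast
  then have "relabel f g = relabel f' g" using gr by (intro relabel_cong simple) auto
  moreover have "act f r = act f' r" using gr f' by (intro cong[of g]) auto
  moreover have "f ` U = V" using U(2) by (simp add: bij_betw_def)
  ultimately show "(case s of (g, r) \<Rightarrow> (relabel f g, act f r)) \<in> {(g, r). g \<in> A \<and> verts g = V \<and> r \<in> R g}"
    using closed[OF gr(2) f'(1)] roots[OF gr(2) f'(1) gr(4)] f'(2) gr(1,3) by (auto simp: image_def)
next
  fix U and f :: "'a \<Rightarrow> 'a" and s
  assume "\<forall>x\<in>U. f x = x" "s \<in> {(g, r). g \<in> A \<and> verts g = U \<and> r \<in> R g}"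
  then show "(case s of (g, r) \<Rightarrow> (relabel f g, act f r)) = s"
    using relabel_cong[of _ f id] cong[of _ _ f id] simple act(1) by auto
next
  fix U V W and f k h :: "'a \<Rightarrow> 'a" and s
  assume h: "\<forall>x\<in>U. h x = k (f x)" and "s \<in> {(g, r). g \<in> A \<and> verts g = U \<and> r \<in> R g}"
  then obtain g r where gr: "s = (g, r)" "g \<in> A" "verts g = U" "r \<in> R g" by blast
  have "relabel h g = relabel (k \<circ> f) g" using gr h by (intro relabel_cong simple) auto
  moreover have "act h r = act (k \<circ> f) r" using gr h by (intro cong[of g]) auto
  ultimately show "(case s of (g, r) \<Rightarrow> (relabel h g, act h r)) =
      (case case s of (g, r) \<Rightarrow> (relabel f g, act f r) of (g, r) \<Rightarrow> (relabel k g, act k r))"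
    using gr by (simp add: relabel_comp act(2))
qed

text \<open>The natural map selects a node for each graph and each incidence, and so runs from the
  right-hand side of the identity to the left.\<close>

lemma species_iso_sym:
  assumes "S \<cong>\<^sub>S T"
  shows "T \<cong>\<^sub>S S"
proof -
  obtain \<phi> where S: "is_species S" and T: "is_species T"
    and bij: "\<And>U. finite U \<Longrightarrow> bij_betw (\<phi> U) (structs S U) (structs T U)"
    and nat: "\<And>U V f s. finite U \<Longrightarrow> bij_betw f U V \<Longrightarrow> s \<in> structs S U \<Longrightarrow>
      \<phi> V (transport S U f s) = transport T U f (\<phi> U s)"
    using assms unfolding species_iso_def by metis
  define \<psi> where "\<psi> U = inv_into (structs S U) (\<phi> U)" for U
  have "bij_betw (\<psi> U) (structs T U) (structs S U)" if "finite U" for U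
    unfolding \<psi>_def by (rule bij_betw_inv_into[OF bij[OF that]])
  moreover have "\<psi> V (transport T U f t) = transport S U f (\<psi> U t)"
    if U: "finite U" "bij_betw f U V" and t: "t \<in> structs T U" for U V f t
  proof -
    have V: "finite V" using U bij_betw_finite by blast
    obtain s where s: "s \<in> structs S U" "t = \<phi> U s" using t bij[OF U(1)] by (auto simp: bij_betw_def)
    have "transport S U f s \<in> structs S V" by (rule is_speciesD(2)[OF S U s(1)])
    then have "\<psi> V (\<phi> V (transport S U f s)) = transport S U f s"
      using bij[OF V] by (simp add: \<psi>_def bij_betw_def)
    moreover have "\<psi> U t = s" using s bij[OF U(1)] by (simp add: \<psi>_def bij_betw_def)
    ultimately show ?thesis using nat[OF U s(1)] s(2) by simp
  qed
  ultimately show ?thesis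
    using S T unfolding species_iso_def by (intro conjI exI[of _ \<psi>] allI impI ballI)
qed

section \<open>The species of the identity as species of rooted graphs\<close>

lemma K2_decomposition: "is_K2 g \<Longrightarrow> three_components g = {} \<and> bonds g = {}"
  using three_decomposition_eq[of g "{}" "{}"] by (simp add: two_connected_def is_three_decomposition_def)

lemma two_connected_simple: "two_connected g \<Longrightarrow> simple_graph g"
  by (auto simp: two_connected_def k_connected_def is_K2_def simple_graph_def)

lemma decomposition_subset:
  assumes "two_connected g"
  shows "c \<in> three_components g \<Longrightarrow> simple_graph c \<and> verts c \<subseteq> verts g"
    and "b \<in> bonds g \<Longrightarrow> b \<subseteq> verts g"
    and "finite (three_components g)" "finite (bonds g)"
proof -
  have *: "(\<forall>c\<in>three_components g. simple_graph c \<and> verts c \<subseteq> verts g) \<and> (\<forall>b\<in>bonds g. b \<subseteq> verts g) \<and>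
      finite (three_components g) \<and> finite (bonds g)"
  proof (cases "is_K2 g")
    case True
    then show ?thesis using K2_decomposition[of g] by simp
  next
    case False
    then have g: "biconnected g" using assms by (simp add: two_connected_def)
    show ?thesis
      using component_facts[OF the_splits[OF g] g] bond_subset(1)[OF the_splits[OF g] g]
        finite_nodes[OF g] by (simp add: biconnectedD(1))
  qed
  show "c \<in> three_components g \<Longrightarrow> simple_graph c \<and> verts c \<subseteq> verts g"
    and "b \<in> bonds g \<Longrightarrow> b \<subseteq> verts g"
    and "finite (three_components g)" "finite (bonds g)" using * by blast+
qed

lemma B_class_two_connected: "g \<in> B_class F \<Longrightarrow> two_connected g"
  by (simp add: B_class_def)

lemma B_class_relabel:
  assumes F: "is_species (graph_species F)" and g: "g \<in> B_class F" and f: "bij f"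
  shows "relabel f g \<in> B_class F"
proof -
  have tc: "two_connected g" using g by (simp add: B_class_def)
  have "relabel f c \<in> F" if c: "c \<in> three_components g" "k_connected 3 (relabel f c)" for c
  proof -
    have k: "k_connected 3 c" using c(2) relabel_iff(1)[OF f] by blast
    then have "c \<in> structs (graph_species F) (verts c)" "finite (verts c)"
      using g c(1) by (auto simp: B_class_def graph_species_def k_connected_def simple_graph_def)
    moreover have "bij_betw f (verts c) (f ` verts c)"
      by (rule bij_betw_subset[OF f subset_UNIV refl])
    ultimately have "transport (graph_species F) (verts c) f c \<in> structs (graph_species F) (f ` verts c)"
      using is_speciesD(2)[OF F] by blast
    then show ?thesis by (simp add: graph_species_def)
  qed
  then show ?thesis
    using two_connected_relabel[OF f tc] three_decomposition_relabel(1)[OF tc f] by (auto simp: B_class_def)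
qed

lemma incidences_subset: "(c, b) \<in> incidences g \<Longrightarrow> c \<in> three_components g \<and> b \<in> bonds g"
  by (auto simp: incidences_def linked_def)

lemma component_rooted_eq: "B_component_rooted F = rooted_species (B_class F) three_components relabel"
  by (auto simp: B_component_rooted_def rooted_species_def B_species_def graph_species_def)

lemma bond_rooted_eq: "B_bond_rooted F = rooted_species (B_class F) bonds image"
  by (auto simp: B_bond_rooted_def rooted_species_def B_species_def graph_species_def)

lemma component_bond_rooted_eq:
  "B_component_bond_rooted F = rooted_species (B_class F) incidences (\<lambda>f. map_prod (relabel f) (image f))"
  by (auto simp: B_component_bond_rooted_def rooted_species_def B_species_def graph_species_def tc_edge_iff
      fun_eq_iff)

lemma difference_eq: "B_species F -\<^sub>S K2_species = graph_species (B_class F - {g. is_K2 g})"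
  by (auto simp: species_diff_def B_species_def K2_species_def graph_species_def fun_eq_iff)

context
  fixes F :: "'v ugraph set"
  assumes F: "is_species (graph_species F)"
begin

lemma species_component_rooted: "is_species (B_component_rooted F)"
  unfolding component_rooted_eq
proof (rule is_species_rooted)
  fix g assume g: "g \<in> B_class F"
  then have tc: "two_connected g" by (rule B_class_two_connected)
  show "simple_graph g" using tc by (rule two_connected_simple)
  show "finite (three_components g)" using tc by (rule decomposition_subset)
  fix f :: "'v \<Rightarrow> 'v"
  show "relabel f g \<in> B_class F" if "bij f" using B_class_relabel[OF F g that] .
  fix c assume c: "c \<in> three_components g"
  show "relabel f c \<in> three_components (relabel f g)" if "bij f"
    using c three_decomposition_relabel(1)[OF tc that] by blast
  fix f' assume "\<And>x. x \<in> verts g \<Longrightarrow> f x = f' x"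
  then show "relabel f c = relabel f' c"
    using decomposition_subset(1)[OF tc c] by (intro relabel_cong) auto
qed (auto simp: relabel_comp)

lemma species_bond_rooted: "is_species (B_bond_rooted F)"
  unfolding bond_rooted_eq
proof (rule is_species_rooted)
  fix g assume g: "g \<in> B_class F"
  then have tc: "two_connected g" by (rule B_class_two_connected)
  show "simple_graph g" using tc by (rule two_connected_simple)
  show "finite (bonds g)" using tc by (rule decomposition_subset)
  fix f :: "'v \<Rightarrow> 'v"
  show "relabel f g \<in> B_class F" if "bij f" using B_class_relabel[OF F g that] .
  fix b assume b: "b \<in> bonds g"
  show "f ` b \<in> bonds (relabel f g)" if "bij f"
    using b three_decomposition_relabel(2)[OF tc that] by blast
  fix f' assume "\<And>x. x \<in> verts g \<Longrightarrow> f x = f' x"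
  then show "f ` b = f' ` b" using decomposition_subset(2)[OF tc b] by (intro image_cong) auto
qed (auto simp: image_comp)

lemma species_component_bond_rooted: "is_species (B_component_bond_rooted F)"
  unfolding component_bond_rooted_eq
proof (rule is_species_rooted)
  fix g assume g: "g \<in> B_class F"
  then have tc: "two_connected g" by (rule B_class_two_connected)
  show "simple_graph g" using tc by (rule two_connected_simple)
  show "finite (incidences g)"
    by (rule finite_subset[of _ "three_components g \<times> bonds g"])
      (use incidences_subset decomposition_subset(3,4)[OF tc] in auto)
  fix f :: "'v \<Rightarrow> 'v" 
  show "relabel f g \<in> B_class F" if "bij f" using B_class_relabel[OF F g that] .
  fix r assume r: "r \<in> incidences g"
  show "map_prod (relabel f) (image f) r \<in> incidences (relabel f g)" if "bij f"
    using r incidences_relabel[OF tc that] by blast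
  fix f' assume eq: "\<And>x. x \<in> verts g \<Longrightarrow> f x = f' x"
  obtain c b where cb: "r = (c, b)" "c \<in> three_components g" "b \<in> bonds g"
    using r incidences_subset by (cases r) blast
  have "relabel f c = relabel f' c"
    using decomposition_subset(1)[OF tc cb(2)] eq by (intro relabel_cong) auto
  moreover have "f ` b = f' ` b"
    using decomposition_subset(2)[OF tc cb(3)] eq by (intro image_cong) auto
  ultimately show "map_prod (relabel f) (image f) r = map_prod (relabel f') (image f') r"
    using cb(1) by simp
qed (auto simp: relabel_comp image_comp)

lemma species_difference: "is_species (B_species F -\<^sub>S K2_species)"
  unfolding difference_eq
proof (rule is_species_graphs)
  fix g assume g: "g \<in> B_class F - {g. is_K2 g}"
  then have "two_connected g" by (auto intro: B_class_two_connected)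
  then show "simple_graph g" by (rule two_connected_simple)
  show "relabel f g \<in> B_class F - {g. is_K2 g}" if "bij f" for f
    using g B_class_relabel[OF F _ that, of g] relabel_iff(2)[OF that, of g] by simp
qed

end

section \<open>The bijection behind the dissymmetry identity\<close>

definition tag :: "'v ugraph \<Rightarrow> 'v ugraph + 'v set \<Rightarrow> ('v ugraph \<times> 'v ugraph) + ('v ugraph \<times> 'v set)" where
  "tag g v = map_sum (Pair g) (Pair g) v"

text \<open>An unrooted graph is rooted at the node that no incidence claims, and an incidence is
  replaced by the node it claims; \<open>tag\<close> sorts the outcome into the two
  summands.\<close>

fun dissymmetry ::
  "'v ugraph + ('v ugraph \<times> 'v ugraph \<times> 'v set) \<Rightarrow> ('v ugraph \<times> 'v ugraph) + ('v ugraph \<times> 'v set)" where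
  "dissymmetry (Inl g) = tag g (root g)"
| "dissymmetry (Inr (g, i)) = tag g (lighter_end g i)"

lemma tag_inject: "tag g v = tag g' v' \<longleftrightarrow> g = g' \<and> v = v'"
  by (cases v; cases v') (auto simp: tag_def)

text \<open>The graph itself is never changed, so this is \<open>nodes_eq\<close> and
  \<open>lighter_end_inj\<close> for each graph separately. The one-edge graph has neither nodes nor
  incidences, which is why it is removed from the domain.\<close>

lemma dissymmetry_bij:
  fixes A :: "'v ugraph set"
  assumes A: "\<And>g. g \<in> A \<Longrightarrow> two_connected g"
  shows "bij_betw dissymmetry
    ((A - {g. is_K2 g}) <+> {(g, i). g \<in> A \<and> i \<in> incidences g})
    ({(g, c). g \<in> A \<and> c \<in> three_components g} <+> {(g, b). g \<in> A \<and> b \<in> bonds g})"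
    (is "bij_betw _ ?T ?S")
proof -
  have bic: "biconnected g" if "g \<in> A" "\<not> is_K2 g" for g using A that by (auto simp: two_connected_def)
  have nK2: "\<not> is_K2 g" if "i \<in> incidences g" for g :: "'v ugraph" and i
    using K2_decomposition[of g] that by (auto simp: incidences_def)
  have "tag g ` nodes g = Pair g ` three_components g <+> Pair g ` bonds g" for g :: "'v ugraph"
    by (simp add: tag_def nodes_def Plus_def image_Un image_image)
  then have S: "?S = (\<Union>g\<in>A. tag g ` nodes g)" by (simp only:) auto
  have SK: "nodes g = {}" if "is_K2 g" for g :: "'v ugraph" using K2_decomposition[OF that] by (simp add: nodes_def)
  have T: "?T = Inl ` (A - {g. is_K2 g}) \<union> (\<Union>g\<in>A - {g. is_K2 g}. (\<lambda>i. Inr (g, i)) ` incidences g)"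
    using nK2 by auto
  have "dissymmetry ` ?T = (\<Union>g\<in>A - {g. is_K2 g}. tag g ` insert (root g) (lighter_end g ` incidences g))"
    unfolding T image_Un image_UN image_image image_insert dissymmetry.simps by blast
  also have "\<dots> = (\<Union>g\<in>A - {g. is_K2 g}. tag g ` nodes g)" using nodes_eq bic by (intro SUP_cong) auto
  also have "\<dots> = (\<Union>g\<in>A. tag g ` nodes g)" using SK by auto
  also have "\<dots> = ?S" by (rule S[symmetric])
  finally have "dissymmetry ` ?T = ?S" .
  moreover have "inj_on dissymmetry ?T"
  proof (rule inj_onI)
    have neq: "dissymmetry (Inl g) \<noteq> dissymmetry (Inr (g', i))" if "i \<in> incidences g'" "g' \<in> A" for g g' i
      using root_in[OF bic[OF that(2) nK2[OF that(1)]]] that(1) by (auto simp: tag_inject)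
    fix s t assume st: "s \<in> ?T" "t \<in> ?T" "dissymmetry s = dissymmetry t"
    from st(1,2) consider g g' where "s = Inl g" "t = Inl g'"
      | g g' i where "s = Inl g" "t = Inr (g', i)" "i \<in> incidences g'" "g' \<in> A"
      | g g' i where "s = Inr (g', i)" "t = Inl g" "i \<in> incidences g'" "g' \<in> A"
      | g i g' i' where "s = Inr (g, i)" "t = Inr (g', i')" "i \<in> incidences g" "g \<in> A" "i' \<in> incidences g'"
      by fast
    then show "s = t"
    proof cases
      case 1
      then show ?thesis using st(3) by (simp add: tag_inject)
    next
      case 2
      then show ?thesis using neq st(3) by blast
    next
      case 3
      then show ?thesis using neq st(3) by metis
    next
      case 4
      then have "g = g'" "lighter_end g i = lighter_end g i'"
        using st(3) by (auto simp: tag_inject simp del: lighter_end.simps)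
      then show ?thesis
        using inj_onD[OF lighter_end_inj[OF bic[OF 4(4) nK2[OF 4(3)]]], of i i'] 4 by simp
    qed
  qed
  ultimately show ?thesis by (simp add: bij_betw_def)
qed

theorem theorem1:
  fixes F :: "'v ugraph set"
  assumes "is_species (graph_species F)"
    and "\<And>h. h \<in> F \<Longrightarrow> k_connected 3 h"
  shows "B_component_rooted F +\<^sub>S B_bond_rooted F \<cong>\<^sub>S
    (B_species F -\<^sub>S K2_species) +\<^sub>S B_component_bond_rooted F"
proof (rule species_iso_sym)
  note F = assms(1)
  note eqs = component_rooted_eq bond_rooted_eq component_bond_rooted_eq difference_eq
  let ?S = "B_component_rooted F +\<^sub>S B_bond_rooted F"
  let ?T = "(B_species F -\<^sub>S K2_species) +\<^sub>S B_component_bond_rooted F"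
  let ?B = "\<lambda>U. {g \<in> B_class F. verts g = U}"
  have structs: "structs ?T U = (?B U - {g. is_K2 g}) <+> {(g, i). g \<in> ?B U \<and> i \<in> incidences g}"
    "structs ?S U = {(g, c). g \<in> ?B U \<and> c \<in> three_components g} <+> {(g, b). g \<in> ?B U \<and> b \<in> bonds g}" for U
    unfolding eqs by (auto simp: species_sum_def graph_species_def rooted_species_def)
  have bij: "bij_betw dissymmetry (structs ?T U) (structs ?S U)" for U
    unfolding structs by (rule dissymmetry_bij) (simp add: B_class_def)
  have transportS: "transport ?S U f (tag g v) = tag (relabel f g) (map_sum (relabel f) (image f) v)" for U f g v
    unfolding eqs by (cases v) (auto simp: tag_def species_sum_def rooted_species_def)
  have natural: "dissymmetry (transport ?T U f t) = transport ?S U f (dissymmetry t)"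
    if U: "finite U" "bij_betw f U V" and t: "t \<in> structs ?T U" for U V f t
  proof -
    \<comment> \<open>Graphs on \<open>U\<close>, their components and their bonds all live inside
      \<open>U\<close>, so \<open>f\<close> and its extension relabel them alike.\<close>
    obtain f' where f': "bij f'" "\<And>x. x \<in> U \<Longrightarrow> f' x = f x" using bij_betw_extend[OF U] by blast
    have g_eq: "relabel f g = relabel f' g" if "g \<in> ?B U" for g
      using that f' two_connected_simple by (intro relabel_cong) (auto simp: B_class_def)
    have node_eq: "map_sum (relabel f) (image f) v = map_sum (relabel f') (image f') v"
      if g: "g \<in> ?B U" and v: "v \<in> nodes g" for g v
    proof -
      have tc: "two_connected g" and V: "verts g = U" using g by (auto simp: B_class_def)
      show ?thesis
      proof (cases v)
        case (Inl c)
        then have "simple_graph c" "verts c \<subseteq> U"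
          using v decomposition_subset(1)[OF tc] V by (auto simp: nodes_def)
        then have "relabel f c = relabel f' c" using f' by (intro relabel_cong) auto
        then show ?thesis using Inl by simp
      next
        case (Inr b)
        then have "b \<subseteq> U" using v decomposition_subset(2)[OF tc] V by (auto simp: nodes_def)
        then have "f ` b = f' ` b" using f' by (intro image_cong) auto
        then show ?thesis using Inr by simp
      qed
    qed
    show ?thesis
    proof (cases t)
      case (Inl g)
      then have g: "g \<in> ?B U" "\<not> is_K2 g" using t unfolding structs by auto
      then have bic: "biconnected g" by (auto simp: B_class_def two_connected_def)
      have "transport ?T U f t = Inl (relabel f' g)"
        unfolding Inl eqs using g_eq[OF g(1)] by (simp add: species_sum_def graph_species_def)
      then show ?thesis
        unfolding Inl using root_relabel[OF bic f'(1)] node_eq[OF g(1), of "root g"] root_in[OF bic] g_eq[OF g(1)]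
        by (simp add: transportS)
    next
      case (Inr s)
      then obtain g c b where s: "s = (g, c, b)" and g: "g \<in> ?B U" and i: "(c, b) \<in> incidences g"
        using t unfolding structs by auto
      have nodes: "Inl c \<in> nodes g" "Inr b \<in> nodes g" using incidences_subset[OF i] by (auto simp: nodes_def)
      have "relabel f c = relabel f' c" "f ` b = f' ` b"
        using node_eq[OF g nodes(1)] node_eq[OF g nodes(2)] by auto
      then have "transport ?T U f t = Inr (relabel f' g, relabel f' c, f' ` b)"
        unfolding Inr s eqs using g_eq[OF g] by (simp add: species_sum_def rooted_species_def)
      moreover have "lighter_end g (c, b) \<in> nodes g" using nodes by simp
      ultimately show ?thesis
        unfolding Inr s using lighter_end_relabel[OF f'(1), of g c b] node_eq[OF g] g_eq[OF g]
        by (simp add: transportS del: lighter_end.simps)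
    qed
  qed
  have "is_species ?S" "is_species ?T"
    by (intro is_species_sum species_component_rooted species_bond_rooted species_difference
        species_component_bond_rooted F)+
  then show "?T \<cong>\<^sub>S ?S"
    unfolding species_iso_def using bij natural by (intro conjI exI[of _ "\<lambda>U. dissymmetry"]) blast+
qed

end
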